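(* Let $\rho(r)$ be a proximate order for the order $\rho$, $0<\rho<\infty$, and let $f(\mathbf x)=\sum_{|\mathbf m|=0}^\infty V_{\mathbf m}(\mathbf x)a_{\mathbf m}\in\mathcal M_L(\mathbb R^{n+1})$ be a left monogenic entire function of finite order $\rho>0$ and of proximate order $\rho(r)$. Then its type $\sigma$ with respect to $\rho(r)$ is given by $$\frac1\rho\ln(\sigma)=\limsup_{q\to\infty}\left(\frac1q\ln K_q+\ln\varphi(q)\right)-\frac1\rho-\frac{\ln(\rho)}{\rho}.$$
   Context: Clifford algebra and monogenic functions: $\mathbb R_n$ is the real Clifford algebra over imaginary units $e_1,\dots,e_n$ with $e_i^2=-1$, $e_ie_j+e_je_i=0$ ($i\ne j$); for $y=\sum_A y_Ae_A$ put $\|y\|^2=\sum_A y_A^2$. Points of $\mathbb R^{n+1}$ are identified with paravectors $\mathbf x=x_0+\sum_{j=1}^n x_je_j$. $\mathcal M_L(\mathbb R^{n+1})$ is the set of $f\in C^1(\mathbb R^{n+1},\mathbb R_n)$ with $\partial_{x_0}f+\sum_{i=1}^n e_i\partial_{x_i}f=0$ (entire left monogenic functions). For $\mathbf m\in\mathbb N_0^n$: $|\mathbf m|=m_1+\dots+m_n$, $\mathbf m!=m_1!\cdots m_n!$. With $z_j=x_j-x_0e_j$, the Fueter polynomial is $V_{\mathbf m}(\mathbf x)=\frac{\mathbf m!}{|\mathbf m|!}\sum z_{j_1}\cdots z_{j_{|\mathbf m|}}$, summed over all distinct sequences $(j_1,\dots,j_{|\mathbf m|})$ in which each index $i$ occurs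 exactly $m_i$ times. Every $f\in\mathcal M_L(\mathbb R^{n+1})$ has a unique Taylor expansion $f=\sum_{\mathbf m}V_{\mathbf m}a_{\mathbf m}$ with $a_{\mathbf m}=\frac1{\mathbf m!}\partial_{x_1}^{m_1}\cdots\partial_{x_n}^{m_n}f(0)\in\mathbb R_n$. Set $K_q=\sup_{\|\mathbf x\|\le1}\big\|\sum_{|\mathbf m|=q}V_{\mathbf m}(\mathbf x)a_{\mathbf m}\big\|$ and $M(r,f)=\sup_{\|\mathbf x\|=r}\|f(\mathbf x)\|$. The order of $f$ is $\limsup_{r\to\infty}\frac{\log^+\log^+M(r,f)}{\log r}$, and its type with respect to $\rho(r)$ is $\sigma=\limsup_{r\to+\infty}\frac{\sup_{\|\mathbf x\|\le r}\ln\|f(\mathbf x)\|}{r^{\rho(r)}}$. Conventions: $\ln0=-\infty$, $\ln(+\infty)=+\infty$. "Of proximate order $\rho(r)$" means that $\rho(r)$ is the proximate order for $\rho$ with respect to which the type is measured. Proximate orders: a differentiable function $\rho(r)\ge0$ on $r\ge0$ is a proximate order for the order $\rho\ge0$ if $\lim_{r\to+\infty}\rho(r)=\rho$ and $\lim_{r\to+\infty}\rho'(r)\,r\ln r=0$. A normalization $\hat\rho(r)$ of $\rho(r)$ (for $\rho>0$) is a proximate order such that $\hat\rho(r)=\rho(r)$ for all $r\ge r_1$, for some $r_1>0$, and $r\mapsto r^{\hat\rho(r)}$ is strictly increasing on $r>0$ and maps $(0,+\infty)$ onto $(0,+\infty)$; fix one. $\varphi:(0,+\infty)\to(0,+\infty)$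 is the inverse function of $t=r^{\hat\rho(r)}$. *)

theory Defs
  imports "HOL-Analysis.Analysis"
begin

section \<open>The real Clifford algebra\<close>

text \<open>
  The linearly ordered finite type \<^typ>\<open>'n\<close> is the index set \<open>{1, ..., n}\<close>. The basis element
  \<open>e_A = e_{i1} ... e_{ik}\<close>, for \<open>A = {i1 < ... < ik}\<close>, is \<open>axis A 1\<close>, so that the library norm
  is \<open>(sum over A of y_A^2)^(1/2)\<close>. The library also has a componentwise \<open>*\<close> on this type; it is
  not used here.
\<close>

type_synonym 'n clifford = "(real, 'n set) vec"

definition e_basis :: "'n set \<Rightarrow> 'n::{finite,linorder} clifford" where
  "e_basis A = axis A 1"

definition e_one :: "'n::{finite,linorder} clifford" where
  "e_one = e_basis {}"

definition e_unit :: "'n \<Rightarrow> 'n::{finite,linorder} clifford" where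
  "e_unit i = e_basis {i}"

text \<open>
  Sorting the word \<open>e_A e_B\<close> costs one sign for every pair \<open>j < i\<close> with \<open>i\<close> in \<open>A\<close> and \<open>j\<close> in \<open>B\<close>,
  and one more for every common index, since \<open>e_i^2 = -1\<close>.
\<close>

definition cl_sign :: "'n set \<Rightarrow> 'n::{finite,linorder} set \<Rightarrow> real" where
  "cl_sign A B = (\<Prod>i\<in>A. \<Prod>j\<in>B. if j \<le> i then - 1 else 1)"

definition cl_mult :: "'n clifford \<Rightarrow> 'n clifford \<Rightarrow> 'n::{finite,linorder} clifford"
    (infixl "\<odot>" 70) where
  "a \<odot> b = (\<Sum>A\<in>UNIV. \<Sum>B\<in>UNIV. (a $ A * b $ B * cl_sign A B) *\<^sub>R e_basis (sym_diff A B))"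

lemma cl_mult_add_left: "(a + b) \<odot> c = a \<odot> c + b \<odot> c"
  by (simp add: cl_mult_def distrib_right scaleR_add_left sum.distrib)

lemma cl_mult_add_right: "a \<odot> (b + c) = a \<odot> b + a \<odot> c"
  by (simp add: cl_mult_def distrib_left distrib_right scaleR_add_left sum.distrib)

lemma cl_mult_scaleR_left: "(r *\<^sub>R a) \<odot> b = r *\<^sub>R (a \<odot> b)"
  by (simp add: cl_mult_def scaleR_sum_right mult.assoc)

lemma cl_mult_scaleR_right: "a \<odot> (r *\<^sub>R b) = r *\<^sub>R (a \<odot> b)"
  by (simp add: cl_mult_def scaleR_sum_right algebra_simps)

lemma bilinear_cl_mult: "bilinear (\<odot>)"
  unfolding bilinear_def
  by (auto intro!: linearI simp: cl_mult_add_left cl_mult_add_right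
      cl_mult_scaleR_left cl_mult_scaleR_right)

lemma cl_mult_e_basis: "e_basis A \<odot> e_basis B = cl_sign A B *\<^sub>R e_basis (sym_diff A B)"
proof -
  have "e_basis A \<odot> e_basis B = (\<Sum>A'\<in>UNIV. if A' = A then (\<Sum>B'\<in>UNIV. if B' = B
      then cl_sign A B *\<^sub>R e_basis (sym_diff A B) else 0) else 0)"
    unfolding cl_mult_def
  proof (intro sum.cong refl)
    fix A' :: "'a set"
    show "(\<Sum>B'\<in>UNIV. (e_basis A $ A' * e_basis B $ B' * cl_sign A' B') *\<^sub>R
        e_basis (sym_diff A' B')) = (if A' = A then (\<Sum>B'\<in>UNIV. if B' = B
        then cl_sign A B *\<^sub>R e_basis (sym_diff A B) else 0) else 0)"
    proof (cases "A' = A")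
      case True
      have "(e_basis A $ A' * e_basis B $ B' * cl_sign A' B') *\<^sub>R e_basis (sym_diff A' B') =
          (if B' = B then cl_sign A B *\<^sub>R e_basis (sym_diff A B) else 0)" for B'
        using True by (simp add: e_basis_def[of A] e_basis_def[of B] axis_def)
      with True show ?thesis by simp
    qed (simp add: e_basis_def[of A] axis_def)
  qed
  then show ?thesis by simp
qed

lemma clifford_expansion: "a = (\<Sum>A\<in>UNIV. a $ A *\<^sub>R e_basis A)"
  by (simp add: vec_eq_iff e_basis_def axis_def if_distrib sum_component cong: if_cong)

lemma cl_sign_empty [simp]: "cl_sign {} B = 1" "cl_sign A {} = 1"
  by (simp_all add: cl_sign_def)

lemma cl_mult_one_left: "e_one \<odot> a = a"
proof -
  have "e_one \<odot> a = (\<Sum>A\<in>UNIV. a $ A *\<^sub>R (e_one \<odot> e_basis A))"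
    by (subst clifford_expansion[of a])
       (simp add: linear_sum[OF bilinear_cl_mult[unfolded bilinear_def, THEN conjunct1, rule_format]]
         cl_mult_scaleR_right)
  then show ?thesis
    by (simp add: e_one_def cl_mult_e_basis clifford_expansion[symmetric])
qed

lemma cl_mult_one_right: "a \<odot> e_one = a"
proof -
  have "a \<odot> e_one = (\<Sum>A\<in>UNIV. a $ A *\<^sub>R (e_basis A \<odot> e_one))"
    by (subst clifford_expansion[of a])
       (simp add: linear_sum[OF bilinear_cl_mult[unfolded bilinear_def, THEN conjunct2, rule_format]]
         cl_mult_scaleR_left)
  then show ?thesis
    by (simp add: e_one_def cl_mult_e_basis clifford_expansion[symmetric])
qed

lemma e_unit_square: "e_unit i \<odot> e_unit i = - e_one"
  by (simp add: e_unit_def cl_mult_e_basis cl_sign_def e_one_def)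

lemma e_unit_anticommute:
  assumes "i \<noteq> j"
  shows "e_unit i \<odot> e_unit j + e_unit j \<odot> e_unit i = 0"
proof -
  have "sym_diff {i} {j} = {i, j}" "sym_diff {j} {i} = {i, j}"
    using assms by auto
  moreover have "cl_sign {i} {j} = - cl_sign {j} {i}"
    using assms by (auto simp: cl_sign_def)
  ultimately show ?thesis
    by (simp add: e_unit_def cl_mult_e_basis)
qed

lemma e_basis_insert:
  assumes "\<And>j. j \<in> A \<Longrightarrow> i < j"
  shows "e_basis (insert i A) = e_unit i \<odot> e_basis A"
proof -
  have "sym_diff {i} A = insert i A" using assms by auto
  moreover have "cl_sign {i} A = 1"
    using assms by (auto simp: cl_sign_def not_le intro!: prod.neutral)
  ultimately show ?thesis
    by (simp add: e_unit_def cl_mult_e_basis)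
qed

lemma prod_sym_diff_sign:
  fixes g :: "'a::finite \<Rightarrow> real"
  assumes "\<And>i. g i * g i = 1"
  shows "prod g (sym_diff A B) = prod g A * prod g B"
proof -
  have A: "prod g A = prod g (A - B) * prod g (A \<inter> B)"
    by (subst prod.union_disjoint[symmetric]) (auto intro!: prod.cong)
  have B: "prod g B = prod g (B - A) * prod g (A \<inter> B)"
    by (subst prod.union_disjoint[symmetric]) (auto intro!: prod.cong)
  have "prod g (A \<inter> B) * prod g (A \<inter> B) = 1"
    using assms by (simp flip: prod.distrib)
  moreover have "prod g (sym_diff A B) = prod g (A - B) * prod g (B - A)"
    by (rule prod.union_disjoint) auto
  ultimately show ?thesis by (simp add: A B mult.assoc mult.left_commute)
qed

lemma cl_sign_sym_diff_left: "cl_sign (sym_diff A B) C = cl_sign A C * cl_sign B C"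
  unfolding cl_sign_def by (rule prod_sym_diff_sign) (auto simp flip: prod.distrib intro!: prod.neutral)

lemma cl_sign_sym_diff_right: "cl_sign A (sym_diff B C) = cl_sign A B * cl_sign A C"
proof -
  have "cl_sign A (sym_diff B C) = (\<Prod>i\<in>A. (\<Prod>j\<in>B. if j \<le> i then - 1 else 1) *
      (\<Prod>j\<in>C. if j \<le> i then - 1 else 1))"
    unfolding cl_sign_def by (intro prod.cong refl prod_sym_diff_sign) simp
  then show ?thesis by (simp add: cl_sign_def prod.distrib)
qed

lemma cl_mult_assoc: "a \<odot> b \<odot> c = a \<odot> (b \<odot> c)"
proof -
  have L: "linear (\<lambda>a. a \<odot> b)" "linear (\<lambda>b. a \<odot> b)" for a b :: "'a clifford"
    using bilinear_cl_mult by (auto simp: bilinear_def)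
  have basis: "e_basis A \<odot> e_basis B \<odot> e_basis C = e_basis A \<odot> (e_basis B \<odot> e_basis C)"
    for A B C :: "'a set"
  proof -
    have "sym_diff (sym_diff A B) C = sym_diff A (sym_diff B C)" by auto
    then show ?thesis
      by (simp add: cl_mult_e_basis cl_mult_scaleR_left cl_mult_scaleR_right
          cl_sign_sym_diff_left cl_sign_sym_diff_right mult_ac)
  qed
  have 1: "e_basis A \<odot> e_basis B \<odot> c = e_basis A \<odot> (e_basis B \<odot> c)" for A B :: "'a set" and c
    by (subst (1 2) clifford_expansion[of c])
       (simp add: linear_sum[OF L(2)] cl_mult_scaleR_right basis)
  have 2: "e_basis A \<odot> b \<odot> c = e_basis A \<odot> (b \<odot> c)" for A :: "'a set" and b c
    by (subst (1 2) clifford_expansion[of b])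
       (simp add: linear_sum[OF L(1)] linear_sum[OF L(2)] cl_mult_scaleR_left cl_mult_scaleR_right 1)
  show ?thesis
    by (subst (1 2) clifford_expansion[of a])
       (simp add: linear_sum[OF L(1)] cl_mult_scaleR_left 2)
qed


section \<open>Entire left monogenic functions and Fueter polynomials\<close>

text \<open>The point \<open>x0 + x1 e1 + ... + xn en\<close> is the pair of \<open>x0\<close> and \<open>(x1, ..., xn)\<close>; the norm is Euclidean.\<close>

type_synonym 'n paravec = "real \<times> (real, 'n) vec"

definition entire_left_monogenic :: "('n paravec \<Rightarrow> 'n::{finite,linorder} clifford) \<Rightarrow> bool" where
  "entire_left_monogenic f \<longleftrightarrow>
    (\<exists>f'. (\<forall>x. (f has_derivative blinfun_apply (f' x)) (at x)) \<and> continuous_on UNIV f' \<and>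
      (\<forall>x. blinfun_apply (f' x) (1, 0) +
        (\<Sum>i\<in>UNIV. e_unit i \<odot> blinfun_apply (f' x) (0, axis i 1)) = 0))"

definition fueter_var :: "'n paravec \<Rightarrow> 'n \<Rightarrow> 'n::{finite,linorder} clifford" where
  "fueter_var x j = (snd x $ j) *\<^sub>R e_one - fst x *\<^sub>R e_unit j"

definition mdegree :: "('n::finite \<Rightarrow> nat) \<Rightarrow> nat" where
  "mdegree m = (\<Sum>i\<in>UNIV. m i)"

definition mfact :: "('n::finite \<Rightarrow> nat) \<Rightarrow> real" where
  "mfact m = (\<Prod>i\<in>UNIV. fact (m i))"

definition fueter_poly :: "('n \<Rightarrow> nat) \<Rightarrow> 'n paravec \<Rightarrow> 'n::{finite,linorder} clifford" where
  "fueter_poly m x = (mfact m / fact (mdegree m)) *\<^sub>R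
    (\<Sum>js\<in>{js. \<forall>i. count_list js i = m i}. foldr (\<odot>) (map (fueter_var x) js) e_one)"

definition homogeneous_sup :: "(('n \<Rightarrow> nat) \<Rightarrow> 'n::{finite,linorder} clifford) \<Rightarrow> nat \<Rightarrow> real" where
  "homogeneous_sup a q =
    (SUP x\<in>cball 0 1. norm (\<Sum>m\<in>{m. mdegree m = q}. fueter_poly m x \<odot> a m))"


section \<open>Growth\<close>

definition log_plus :: "real \<Rightarrow> real" where
  "log_plus x = ln (max 1 x)"

text \<open>The logarithm on \<open>[0, \<infinity>]\<close>, with \<open>ln 0 = -\<infinity>\<close> and \<open>ln \<infinity> = \<infinity>\<close>; arguments below 0 do not matter.\<close>

definition ext_ln :: "ereal \<Rightarrow> ereal" where
  "ext_ln t = (if t \<le> 0 then - \<infinity> else if t = \<infinity> then \<infinity> else ereal (ln (real_of_ereal t)))"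

definition max_modulus :: "('n paravec \<Rightarrow> 'n::{finite,linorder} clifford) \<Rightarrow> real \<Rightarrow> real" where
  "max_modulus f r = (SUP x\<in>sphere 0 r. norm (f x))"

definition growth_order :: "('n paravec \<Rightarrow> 'n::{finite,linorder} clifford) \<Rightarrow> ereal" where
  "growth_order f = Limsup at_top (\<lambda>r. ereal (log_plus (log_plus (max_modulus f r)) / ln r))"

definition growth_type ::
    "(real \<Rightarrow> real) \<Rightarrow> ('n paravec \<Rightarrow> 'n::{finite,linorder} clifford) \<Rightarrow> ereal" where
  "growth_type \<rho> f =
    Limsup at_top (\<lambda>r. (SUP x\<in>cball 0 r. ext_ln (ereal (norm (f x)))) / ereal (r powr \<rho> r))"

definition proximate_order :: "(real \<Rightarrow> real) \<Rightarrow> real \<Rightarrow> bool" where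
  "proximate_order \<rho> \<rho>0 \<longleftrightarrow>
    \<rho>0 \<ge> 0 \<and> (\<forall>r\<ge>0. \<rho> r \<ge> 0) \<and> \<rho> differentiable_on {0..} \<and>
    (\<rho> \<longlongrightarrow> \<rho>0) at_top \<and> ((\<lambda>r. deriv \<rho> r * r * ln r) \<longlongrightarrow> 0) at_top"

definition normalization_of :: "(real \<Rightarrow> real) \<Rightarrow> (real \<Rightarrow> real) \<Rightarrow> real \<Rightarrow> bool" where
  "normalization_of \<rho>h \<rho> \<rho>0 \<longleftrightarrow>
    proximate_order \<rho>h \<rho>0 \<and> (\<exists>r1>0. \<forall>r\<ge>r1. \<rho>h r = \<rho> r) \<and>
    strict_mono_on {0<..} (\<lambda>r. r powr \<rho>h r) \<and> (\<lambda>r. r powr \<rho>h r) ` {0<..} = {0<..}"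

definition proximate_inverse :: "(real \<Rightarrow> real) \<Rightarrow> real \<Rightarrow> real" where
  "proximate_inverse \<rho>h = the_inv_into {0<..} (\<lambda>r. r powr \<rho>h r)"

end

theory Submission
  imports Defs "HOL-Library.Multiset" "HOL-Real_Asymp.Real_Asymp"
begin

text \<open>
  Write \<open>f = \<Sum> P_q\<close> with \<open>P_q\<close> homogeneous of degree \<open>q\<close>, so that \<open>K_q\<close> is the supremum of
  \<open>\<parallel>P_q\<parallel>\<close> on the unit ball. Trivially \<open>\<parallel>f(x)\<parallel> \<le> \<Sum> K_q r^q\<close> for \<open>\<parallel>x\<parallel> \<le> r\<close>. Conversely the
  components of \<open>P_q\<close> are harmonic; for the weight \<open>1 - \<parallel>x\<parallel>^2\<close> on the unit ball Green's formula shows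
  that homogeneous harmonic maps of different degrees are orthogonal and that harmonic maps have the
  mean value property. Bessel's inequality followed by the mean value property gives
  \<open>K_q ((1 - 2 e) r)^q \<le> C_e sup {\<parallel>f(x)\<parallel>. \<parallel>x\<parallel> \<le> r}\<close>, a Cauchy estimate whose loss \<open>(1 - 2 e)^q\<close>
  is negligible as \<open>e\<close> tends to 0. What remains is the one-variable relation between coefficients and growth,
  which rests on the Potter bounds: \<open>s^\<rho>(s) / r^\<rho>(r)\<close> is at most \<open>(s/r)^(\<rho> \<plusminus> d)\<close>, for one of the signs,
  when \<open>r\<close> and \<open>s\<close> are large.
\<close>

section \<open>Integrals of compactly supported functions\<close>

lemma integrable_compact_support:
  fixes G :: "'a::euclidean_space \<Rightarrow> 'b::{banach, second_countable_topology}"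
  assumes "continuous_on UNIV G" and "\<And>x. R < norm x \<Longrightarrow> G x = 0"
  shows "integrable lborel G"
proof -
  have "integrable lborel (\<lambda>x. indicator (cball 0 R) x *\<^sub>R G x)"
    by (rule borel_integrable_compact) (auto intro: continuous_on_subset[OF assms(1)])
  moreover have "(\<lambda>x. indicator (cball 0 R) x *\<^sub>R G x) = G"
    using assms(2) by (auto simp: fun_eq_iff indicator_def not_le)
  ultimately show ?thesis by simp
qed

lemma lborel_integral_affine:
  fixes g :: "'a::euclidean_space \<Rightarrow> 'b::euclidean_space" and c :: real
  assumes "g \<in> borel_measurable borel" "c \<noteq> 0"
  shows "integral\<^sup>L lborel g = \<bar>c\<bar> ^ DIM('a) *\<^sub>R integral\<^sup>L lborel (\<lambda>x. g (t + c *\<^sub>R x))"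
proof -
  have "integral\<^sup>L lborel g =
      integral\<^sup>L (density (distr lborel borel (\<lambda>x. t + c *\<^sub>R x)) (\<lambda>_. \<bar>c\<bar> ^ DIM('a))) g"
    using lborel_affine[OF assms(2), of t] by simp
  also have "\<dots> = integral\<^sup>L (distr lborel borel (\<lambda>x. t + c *\<^sub>R x)) (\<lambda>x. \<bar>c\<bar> ^ DIM('a) *\<^sub>R g x)"
    using assms(1) by (subst integral_density) auto
  also have "\<dots> = integral\<^sup>L lborel (\<lambda>x. \<bar>c\<bar> ^ DIM('a) *\<^sub>R g (t + c *\<^sub>R x))"
    using assms(1) by (subst integral_distr) auto
  finally show ?thesis by simp
qed

text \<open>All integrands vanish outside one fixed ball, so the Lebesgue integrals over the whole
  space are integrals over one box, where the Leibniz rule for boxes applies. The parameter interval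
  is closed, so derivatives at its ends are one-sided.\<close>

lemma leibniz_compact_support:
  fixes F F' :: "real \<Rightarrow> 'a::euclidean_space \<Rightarrow> 'b::euclidean_space"
  assumes der: "\<And>t x. t \<in> {0..1} \<Longrightarrow> ((\<lambda>t. F t x) has_vector_derivative F' t x) (at t within {0..1})"
    and contF: "\<And>t. t \<in> {0..1} \<Longrightarrow> continuous_on UNIV (F t)"
    and contF': "continuous_on ({0..1} \<times> UNIV) (\<lambda>(t, x). F' t x)"
    and F0: "\<And>t x. t \<in> {0..1} \<Longrightarrow> R < norm x \<Longrightarrow> F t x = 0"
    and F'0: "\<And>t x. t \<in> {0..1} \<Longrightarrow> R < norm x \<Longrightarrow> F' t x = 0"
    and t: "t \<in> {0..1}"
  shows "((\<lambda>t. integral\<^sup>L lborel (F t)) has_vector_derivative integral\<^sup>L lborel (F' t)) (at t within {0..1})"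
proof -
  obtain c where "cball 0 R \<subseteq> cbox (- c) (c :: 'a)"
    using bounded_subset_cbox_symmetric[OF bounded_cball] by blast
  then have c: "norm x \<le> R \<Longrightarrow> x \<in> cbox (- c) c" for x by (auto simp: subset_eq)
  have eq: "integral\<^sup>L lborel G = integral (cbox (-c) c) G"
    if "continuous_on UNIV G" "\<And>x. R < norm x \<Longrightarrow> G x = 0" for G :: "'a \<Rightarrow> 'b"
  proof -
    have "integrable lborel G" using integrable_compact_support that by blast
    then have "integral\<^sup>L lborel G = integral UNIV G" by (simp add: integral_lborel)
    also have "\<dots> = integral UNIV (\<lambda>x. if x \<in> cbox (-c) c then G x else 0)"
      by (rule arg_cong[where f = "integral UNIV"]) (use c that(2) not_le in \<open>fastforce simp: fun_eq_iff\<close>)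
    also have "\<dots> = integral (cbox (-c) c) G" by (rule integral_restrict_UNIV)
    finally show ?thesis .
  qed
  have contF't: "continuous_on UNIV (F' t)" if "t \<in> {0..1}" for t
  proof -
    have "continuous_on UNIV (Pair t :: 'a \<Rightarrow> _)" by (intro continuous_intros)
    moreover have "range (Pair t) \<subseteq> {0..1} \<times> (UNIV :: 'a set)" using that by auto
    ultimately show ?thesis using continuous_on_compose2[OF contF', of UNIV "Pair t"] by simp
  qed
  have "((\<lambda>t. integral (cbox (-c) c) (F t)) has_vector_derivative integral (cbox (-c) c) (F' t))
      (at t within {0..1})"
    by (rule leibniz_rule_vector_derivative)
      (use t in \<open>auto intro!: der integrable_continuous intro: continuous_on_subset[OF contF] 
         continuous_on_subset[OF contF']\<close>)
  then show ?thesis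
    using t by (subst eq) (auto intro: contF't F'0 elim!: has_vector_derivative_transform[rotated 2]
        intro!: eq contF F0)
qed

text \<open>By translation invariance the integral of \<open>G (x + t *\<^sub>R v)\<close> does not
  depend on \<open>t\<close>; differentiating under the integral at \<open>t = 0\<close> produces
  the integral in question.\<close>

lemma integral_directional_derivative_zero:
  fixes G :: "'a::euclidean_space \<Rightarrow> 'b::euclidean_space"
  assumes der: "\<And>x. (G has_derivative G' x) (at x)"
    and cont: "continuous_on UNIV (\<lambda>x. G' x v)"
    and G0: "\<And>x. R < norm x \<Longrightarrow> G x = 0" and G'0: "\<And>x. R < norm x \<Longrightarrow> G' x v = 0"
  shows "integral\<^sup>L lborel (\<lambda>x. G' x v) = 0"
proof -
  have contG: "continuous_on UNIV G"
    using der by (meson continuous_at_imp_continuous_on has_derivative_continuous)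
  \<comment> \<open>For \<open>t\<close> in \<open>{0..1}\<close> all translates vanish outside the
    ball of radius \<open>R + norm v\<close>, the common support that
    \<open>leibniz_compact_support\<close> asks for.\<close>
  have big: "R < norm (x + t *\<^sub>R v)" if "R + norm v < norm x" "t \<in> {0..1}" for x and t :: real
  proof -
    have "norm (t *\<^sub>R v) \<le> norm v" using that by (simp add: mult_left_le_one_le)
    then show ?thesis using norm_diff_ineq[of x "t *\<^sub>R v"] that by linarith
  qed
  have "((\<lambda>t. integral\<^sup>L lborel (\<lambda>x. G (x + t *\<^sub>R v))) has_vector_derivative
     integral\<^sup>L lborel (\<lambda>x. G' (x + 0 *\<^sub>R v) v)) (at 0 within {0..1})"
  proof (rule leibniz_compact_support[where R = "R + norm v"])
    fix t :: real and x assume "t \<in> {0..1}"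
    have "((\<lambda>t. G (x + t *\<^sub>R v)) has_derivative (\<lambda>h. G' (x + t *\<^sub>R v) (h *\<^sub>R v))) (at t)"
      by (rule has_derivative_compose[of "\<lambda>t. x + t *\<^sub>R v" "\<lambda>h. h *\<^sub>R v" t UNIV G "G' (x + t *\<^sub>R v)"])
        (auto intro!: derivative_eq_intros der)
    then show "((\<lambda>t. G (x + t *\<^sub>R v)) has_vector_derivative G' (x + t *\<^sub>R v) v) (at t within {0..1})"
      unfolding has_vector_derivative_def
      by (rule has_derivative_at_withinI[OF has_derivative_eq_rhs])
        (simp add: linear_simps[OF has_derivative_bounded_linear[OF der]] fun_eq_iff)
  qed (auto intro!: continuous_on_compose2[OF contG] continuous_on_compose2[OF cont] continuous_intros
      G0 G'0 big simp: split_beta)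
  moreover have "integral\<^sup>L lborel (\<lambda>x. G (x + t *\<^sub>R v)) = integral\<^sup>L lborel G" for t
    using lborel_integral_affine[of G 1 "t *\<^sub>R v"] contG
    by (simp add: borel_measurable_continuous_onI add.commute)
  ultimately have "((\<lambda>t. integral\<^sup>L lborel G) has_vector_derivative
     integral\<^sup>L lborel (\<lambda>x. G' x v)) (at (0::real) within {0..1})"
    by simp
  then show ?thesis
    using vector_derivative_unique_within[of 0 "{0..1}", OF _ has_vector_derivative_const]
    by (metis at_within_Icc_at_right trivial_limit_at_right_real zero_less_one)
qed

section \<open>Harmonic maps and the weight on the unit ball\<close>

text \<open>The weight vanishes on the unit sphere, so integration by parts leaves no boundary term.
  The gradient of its square is \<open>- 4 * bump x\<close> times the position vector, so Green's
  formula produces the radial derivative \<open>D x x\<close>, of which homogeneous maps are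
  eigenvectors.\<close>

definition bump :: "'a::real_inner \<Rightarrow> real" where
  "bump x = max 0 (1 - x \<bullet> x)"

lemma continuous_on_bump [continuous_intros]:
  "continuous_on S f \<Longrightarrow> continuous_on S (\<lambda>x. bump (f x))"
  unfolding bump_def by (intro continuous_intros)

lemma bump_nonneg [simp]: "0 \<le> bump x" and bump_le_1: "bump x \<le> 1"
  by (auto simp: bump_def)

lemma bump_eq_0:
  assumes "1 < norm x"
  shows "bump x = 0"
proof -
  have "1 < (norm x)\<^sup>2" using assms by (rule one_less_power) simp
  then show ?thesis by (simp add: bump_def dot_square_norm)
qed

text \<open>Squaring removes the kink of \<open>max 0\<close>: only the argument 0 needs a limit,
  and there the difference quotient is at most \<open>\<bar>h\<bar>\<close>.\<close>

lemma has_derivative_bump_square: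
  "((\<lambda>x. (bump x)\<^sup>2) has_derivative (\<lambda>y. - 4 * bump x * (x \<bullet> y))) (at (x :: 'a::real_inner))"
proof -
  have pos: "((\<lambda>s::real. (max 0 s)\<^sup>2) has_field_derivative 2 * max 0 s) (at s)" for s :: real
  proof -
    consider "s < 0" | "s = 0" | "s > 0" by linarith
    then show ?thesis
    proof cases
      case 1
      have "((\<lambda>s::real. 0) has_field_derivative 2 * max 0 s) (at s)" using 1 by simp
      then show ?thesis
        by (rule has_field_derivative_transform_within_open[where S = "{..<0}"]) (use 1 in auto)
    next
      case 3
      have "((\<lambda>s::real. s\<^sup>2) has_field_derivative 2 * max 0 s) (at s)"
        using 3 by (auto intro!: derivative_eq_intros)
      then show ?thesis
        by (rule has_field_derivative_transform_within_open[where S = "{0<..}"]) (use 3 in auto)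
    next
      case 2
      have "(\<lambda>h::real. (max 0 h)\<^sup>2 / h) \<midarrow>0\<rightarrow> 0"
      proof (rule Lim_null_comparison)
        show "\<forall>\<^sub>F h::real in at 0. norm ((max 0 h)\<^sup>2 / h) \<le> \<bar>h\<bar>"
          by (auto simp: eventually_at_filter max_def power2_eq_square)
        show "(\<lambda>h::real. \<bar>h\<bar>) \<midarrow>0\<rightarrow> 0" by (rule tendsto_rabs_zero) simp
      qed
      then show ?thesis using 2 by (simp add: DERIV_def)
    qed
  qed
  have "((\<lambda>x. 1 - x \<bullet> x) has_derivative (\<lambda>y. - 2 * (x \<bullet> y))) (at x)"
    by (auto intro!: derivative_eq_intros simp: inner_commute)
  from has_derivative_compose[OF this pos[of "1 - x \<bullet> x", unfolded has_field_derivative_def]]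
  show ?thesis unfolding bump_def by (rule has_derivative_eq_rhs) (simp add: fun_eq_iff)
qed

text \<open>The derivatives are explicit arguments, since closed formulas for both are supplied
  later. \<open>H x i j\<close> differentiates \<open>D y i\<close> along \<open>j\<close> at
  \<open>x\<close>, so its trace over \<open>Basis\<close> is the Laplacian.\<close>

definition C2_harmonic ::
    "('a::euclidean_space \<Rightarrow> 'b::euclidean_space) \<Rightarrow> ('a \<Rightarrow> 'a \<Rightarrow> 'b) \<Rightarrow> ('a \<Rightarrow> 'a \<Rightarrow> 'a \<Rightarrow> 'b) \<Rightarrow> bool" where
  "C2_harmonic h D H \<longleftrightarrow>
    (\<forall>x. (h has_derivative D x) (at x)) \<and>
    (\<forall>x i. ((\<lambda>y. D y i) has_derivative H x i) (at x)) \<and>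
    (\<forall>i j. continuous_on UNIV (\<lambda>x. H x i j)) \<and>
    (\<forall>x. (\<Sum>i\<in>Basis. H x i i) = 0)"

lemma C2_harmonicD:
  assumes "C2_harmonic h D H"
  shows "(h has_derivative D x) (at x)" "((\<lambda>y. D y i) has_derivative H x i) (at x)"
    "continuous_on UNIV (\<lambda>x. H x i j)" "(\<Sum>i\<in>Basis. H x i i) = 0"
    "continuous_on UNIV h" "continuous_on UNIV (\<lambda>x. D x i)" "bounded_linear (D x)"
proof -
  show D: "(h has_derivative D x) (at x)" for x
    using assms unfolding C2_harmonic_def by blast
  show H: "((\<lambda>y. D y i) has_derivative H x i) (at x)" for x i
    using assms unfolding C2_harmonic_def by blast
  show "continuous_on UNIV (\<lambda>x. H x i j)" "(\<Sum>i\<in>Basis. H x i i) = 0"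
    using assms unfolding C2_harmonic_def by blast+
  show "continuous_on UNIV h"
    using D by (meson continuous_at_imp_continuous_on has_derivative_continuous)
  show "continuous_on UNIV (\<lambda>x. D x i)"
    using H by (meson continuous_at_imp_continuous_on has_derivative_continuous)
  show "bounded_linear (D x)" using D by (rule has_derivative_bounded_linear)
qed

text \<open>Continuity of \<open>D\<close> is available for fixed directions only; the expansion
  extends it to directions that move with the point, as in \<open>D x x\<close>.\<close>

lemma C2_harmonic_deriv_expand:
  assumes "C2_harmonic h D H"
  shows "D y x = (\<Sum>i\<in>Basis. (x \<bullet> i) *\<^sub>R D y i)"
proof -
  have lin: "linear (D y)"
    using C2_harmonicD(7)[OF assms] by (rule bounded_linear.linear)
  have "D y x = D y (\<Sum>i\<in>Basis. (x \<bullet> i) *\<^sub>R i)" by (simp only: euclidean_representation)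
  also have "\<dots> = (\<Sum>i\<in>Basis. (x \<bullet> i) *\<^sub>R D y i)"
    by (simp only: linear_sum[OF lin] linear_cmul[OF lin])
  finally show ?thesis .
qed

lemma C2_harmonic_affine:
  assumes "C2_harmonic h D H"
  shows "C2_harmonic (\<lambda>x. h (v + c *\<^sub>R x)) (\<lambda>x y. c *\<^sub>R D (v + c *\<^sub>R x) y)
    (\<lambda>x i j. c\<^sup>2 *\<^sub>R H (v + c *\<^sub>R x) i j)"
proof -
  have H: "bounded_linear (H x i)" for x i
    using C2_harmonicD(2)[OF assms] has_derivative_bounded_linear by blast
  have aff: "((\<lambda>x. v + c *\<^sub>R x) has_derivative (\<lambda>y. c *\<^sub>R y)) (at x)" for x
    by (auto intro!: derivative_eq_intros)
  have 1: "((\<lambda>x. h (v + c *\<^sub>R x)) has_derivative (\<lambda>y. c *\<^sub>R D (v + c *\<^sub>R x) y)) (at x)" for x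
    using has_derivative_compose[OF aff C2_harmonicD(1)[OF assms]]
    by (simp add: linear_simps[OF C2_harmonicD(7)[OF assms]])
  have 2: "((\<lambda>x. c *\<^sub>R D (v + c *\<^sub>R x) i) has_derivative (\<lambda>y. c\<^sup>2 *\<^sub>R H (v + c *\<^sub>R x) i y)) (at x)" for x i
    using has_derivative_scaleR_right[OF has_derivative_compose[OF aff C2_harmonicD(2)[OF assms]], of c]
    by (simp add: linear_simps[OF H] power2_eq_square)
  show ?thesis
    unfolding C2_harmonic_def
    using 1 2 by (auto intro!: continuous_intros continuous_on_compose2[OF C2_harmonicD(3)[OF assms]]
        simp: C2_harmonicD(4)[OF assms] simp flip: scaleR_sum_right)
qed

section \<open>Green's formula for the weight, orthogonality and the mean value property\<close>

lemma integrable_bump: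
  fixes g :: "'a::euclidean_space \<Rightarrow> 'b::euclidean_space"
  assumes "continuous_on UNIV g"
  shows "integrable lborel (\<lambda>x. bump x *\<^sub>R g x)"
  by (rule integrable_compact_support[where R = 1]) (auto intro!: continuous_intros assms simp: bump_eq_0)

text \<open>This is the divergence theorem for the compactly supported field with components
  \<open>(bump x)\<^sup>2 * (k x \<bullet> D x i)\<close>. After summation over \<open>Basis\<close>
  the second derivatives form the Laplacian of \<open>h\<close>, which is 0, and the gradient of the
  weight contributes the term with \<open>D x x\<close>.\<close>

lemma green_bump:
  fixes h k :: "'a::euclidean_space \<Rightarrow> 'b::euclidean_space"
  assumes h: "C2_harmonic h D H"
    and k: "\<And>x. (k has_derivative K x) (at x)" "\<And>i. continuous_on UNIV (\<lambda>x. K x i)"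
  shows "4 * integral\<^sup>L lborel (\<lambda>x. bump x * (k x \<bullet> D x x)) =
    integral\<^sup>L lborel (\<lambda>x. (bump x)\<^sup>2 * (\<Sum>i\<in>Basis. K x i \<bullet> D x i))"
proof -
  have contk: "continuous_on UNIV k"
    using k(1) by (meson continuous_at_imp_continuous_on has_derivative_continuous)
  have contD: "continuous_on UNIV (\<lambda>x. D x x)"
    by (subst C2_harmonic_deriv_expand[OF h]) (intro continuous_intros C2_harmonicD(6)[OF h])
  define G' where "G' i x y = (bump x)\<^sup>2 * (k x \<bullet> H x i y + K x y \<bullet> D x i) +
    (- 4 * bump x * (x \<bullet> y)) * (k x \<bullet> D x i)" for i x y
  have der: "((\<lambda>x. (bump x)\<^sup>2 * (k x \<bullet> D x i)) has_derivative G' i x) (at x)" for x i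
    unfolding G'_def
    by (rule has_derivative_eq_rhs,
        rule has_derivative_mult[OF has_derivative_bump_square has_derivative_inner[OF k(1) C2_harmonicD(2)[OF h]]])
      simp
  have cont: "continuous_on UNIV (\<lambda>x. G' i x j)" for i j
    unfolding G'_def by (intro continuous_intros contk k C2_harmonicD[OF h])
  have supp: "G' i x j = 0" if "1 < norm x" for i x j
    using that by (simp add: G'_def bump_eq_0)
  have "integral\<^sup>L lborel (\<lambda>x. G' i x i) = 0" for i
    by (rule integral_directional_derivative_zero[OF der cont, where R = 1]) (auto simp: bump_eq_0 supp)
  moreover have "integrable lborel (\<lambda>x. G' i x i)" for i
    by (rule integrable_compact_support[OF cont, where R = 1]) (auto simp: supp)
  ultimately have "integral\<^sup>L lborel (\<lambda>x. \<Sum>i\<in>Basis. G' i x i) = 0"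
    by (subst Bochner_Integration.integral_sum) auto
  moreover have "(\<Sum>i\<in>Basis. G' i x i) =
      (bump x)\<^sup>2 * (\<Sum>i\<in>Basis. K x i \<bullet> D x i) - 4 * (bump x * (k x \<bullet> D x x))" for x
  proof -
    have "(\<Sum>i\<in>Basis. G' i x i) = (bump x)\<^sup>2 * (k x \<bullet> (\<Sum>i\<in>Basis. H x i i)) +
       (bump x)\<^sup>2 * (\<Sum>i\<in>Basis. K x i \<bullet> D x i) - 4 * bump x * (k x \<bullet> (\<Sum>i\<in>Basis. (x \<bullet> i) *\<^sub>R D x i))"
      by (simp add: G'_def sum.distrib inner_sum_right sum_distrib_left algebra_simps sum_subtractf sum_negf)
    also have "(\<Sum>i\<in>Basis. (x \<bullet> i) *\<^sub>R D x i) = D x x"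
      by (rule C2_harmonic_deriv_expand[OF h, symmetric])
    finally show ?thesis by (simp add: C2_harmonicD(4)[OF h])
  qed
  moreover have "integrable lborel (\<lambda>x. (bump x)\<^sup>2 * (\<Sum>i\<in>Basis. K x i \<bullet> D x i))"
    "integrable lborel (\<lambda>x. 4 * (bump x * (k x \<bullet> D x x)))"
    by (rule integrable_compact_support[where R = 1];
        auto intro!: continuous_intros k C2_harmonicD[OF h] contk contD simp: bump_eq_0)+
  ultimately show ?thesis by simp
qed

text \<open>The right side of Green's formula is symmetric in \<open>h\<close> and \<open>k\<close>,
  so both radial pairings agree. Euler's relation turns them into \<open>q\<close> and
  \<open>p\<close> times the same integral.\<close>

lemma harmonic_orthogonal:
  fixes h k :: "'a::euclidean_space \<Rightarrow> 'b::euclidean_space" and p q :: real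
  assumes h: "C2_harmonic h D H" and k: "C2_harmonic k K L"
    and euler: "\<And>x. D x x = q *\<^sub>R h x" "\<And>x. K x x = p *\<^sub>R k x" and "p \<noteq> q"
  shows "integral\<^sup>L lborel (\<lambda>x. bump x * (h x \<bullet> k x)) = 0"
proof -
  have "4 * integral\<^sup>L lborel (\<lambda>x. bump x * (k x \<bullet> D x x)) =
      4 * integral\<^sup>L lborel (\<lambda>x. bump x * (h x \<bullet> K x x))"
    by (simp only: green_bump[OF h C2_harmonicD(1,6)[OF k]] green_bump[OF k C2_harmonicD(1,6)[OF h]])
      (simp add: inner_commute)
  then have "q * integral\<^sup>L lborel (\<lambda>x. bump x * (h x \<bullet> k x)) = p * integral\<^sup>L lborel (\<lambda>x. bump x * (h x \<bullet> k x))"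
    by (simp add: euler inner_commute mult.left_commute[of "bump _"])
  with \<open>p \<noteq> q\<close> show ?thesis by simp
qed

text \<open>The weighted integral of \<open>h (t *\<^sub>R x)\<close> is constant in
  \<open>t\<close>: its value at \<open>t = 1\<close> is the left side, its value at
  \<open>t = 0\<close> the right side.\<close>

lemma harmonic_mean_value_0:
  fixes h :: "'a::euclidean_space \<Rightarrow> 'b::euclidean_space"
  assumes h: "C2_harmonic h D H"
  shows "integral\<^sup>L lborel (\<lambda>x. bump x *\<^sub>R h x) = integral\<^sup>L lborel (bump :: 'a \<Rightarrow> real) *\<^sub>R h 0"
proof -
  have contD: "continuous_on UNIV (\<lambda>(t, x). bump x *\<^sub>R D (t *\<^sub>R x) x)"
    unfolding split_beta
    by (subst C2_harmonic_deriv_expand[OF h])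
      (intro continuous_intros continuous_on_compose2[OF C2_harmonicD(6)[OF h]] subset_UNIV)
  have D0: "integral\<^sup>L lborel (\<lambda>x. bump x *\<^sub>R D (t *\<^sub>R x) x) = 0" if "t \<noteq> 0" for t
  proof -
    let ?I = "integral\<^sup>L lborel (\<lambda>x. bump x *\<^sub>R D (t *\<^sub>R x) x)"
    have cont: "continuous_on UNIV (\<lambda>x. D (t *\<^sub>R x) x)"
      by (subst C2_harmonic_deriv_expand[OF h])
        (intro continuous_intros continuous_on_compose2[OF C2_harmonicD(6)[OF h]] subset_UNIV)
    \<comment> \<open>Green's formula is tested with the constant map \<open>?I\<close>, whose
      derivative is 0; hence \<open>?I \<bullet> ?I = 0\<close>.\<close>
    have "4 * integral\<^sup>L lborel (\<lambda>x. bump x * (?I \<bullet> (t *\<^sub>R D (0 + t *\<^sub>R x) x))) =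
        integral\<^sup>L lborel (\<lambda>x. (bump x)\<^sup>2 * (\<Sum>i\<in>Basis. 0 \<bullet> (t *\<^sub>R D (0 + t *\<^sub>R x) i)))"
      by (rule green_bump[OF C2_harmonic_affine[OF h]]) auto
    then have "integral\<^sup>L lborel (\<lambda>x. t * (?I \<bullet> (bump x *\<^sub>R D (t *\<^sub>R x) x))) = 0"
      by (simp add: mult.left_commute)
    then have "integral\<^sup>L lborel (\<lambda>x. ?I \<bullet> (bump x *\<^sub>R D (t *\<^sub>R x) x)) = 0"
      using that by simp
    moreover have "integral\<^sup>L lborel (\<lambda>x. ?I \<bullet> (bump x *\<^sub>R D (t *\<^sub>R x) x)) = ?I \<bullet> ?I"
      by (rule integral_inner_right) (rule integrable_bump[OF cont])
    ultimately show "?I = 0" by simp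
  qed
  have der: "((\<lambda>t. integral\<^sup>L lborel (\<lambda>x. bump x *\<^sub>R h (t *\<^sub>R x))) has_vector_derivative
       integral\<^sup>L lborel (\<lambda>x. bump x *\<^sub>R D (t *\<^sub>R x) x)) (at t within {0..1})" if "t \<in> {0..1}" for t
  proof (rule leibniz_compact_support[where R = 1])
    fix t :: real and x :: 'a
    have "((\<lambda>t. h (t *\<^sub>R x)) has_derivative (\<lambda>s. D (t *\<^sub>R x) (s *\<^sub>R x))) (at t)"
      by (rule has_derivative_compose[OF _ C2_harmonicD(1)[OF h]]) (auto intro!: derivative_eq_intros)
    from has_derivative_scaleR_right[OF this, of "bump x"]
    show "((\<lambda>t. bump x *\<^sub>R h (t *\<^sub>R x)) has_vector_derivative bump x *\<^sub>R D (t *\<^sub>R x) x) (at t within {0..1})"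
      unfolding has_vector_derivative_def
      by (rule has_derivative_at_withinI[OF has_derivative_eq_rhs])
        (simp add: linear_simps[OF C2_harmonicD(7)[OF h]] mult.commute fun_eq_iff)
  qed (use that in \<open>auto simp: bump_eq_0 intro!: continuous_intros continuous_on_compose2[OF C2_harmonicD(5)[OF h]]
        intro: continuous_on_subset[OF contD]\<close>)
  have "(\<lambda>t. integral\<^sup>L lborel (\<lambda>x. bump x *\<^sub>R h (t *\<^sub>R x))) 1 = (\<lambda>t. integral\<^sup>L lborel (\<lambda>x. bump x *\<^sub>R h (t *\<^sub>R x))) 0"
  \<comment> \<open>\<open>D0\<close> cancels a factor \<open>t\<close> and so says nothing at
    \<open>t = 0\<close>; this single exceptional point is harmless because the integral is
    continuous in \<open>t\<close>.\<close>
  proof (rule has_derivative_zero_unique_strong_interval[of "{0}" 0 1])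
    fix t :: real assume "t \<in> {0..1} - {0}"
    then show "((\<lambda>t. integral\<^sup>L lborel (\<lambda>x. bump x *\<^sub>R h (t *\<^sub>R x))) has_derivative (\<lambda>h. 0)) (at t within {0..1})"
      using der[of t] D0[of t] by (auto simp: has_vector_derivative_def)
  next
    show "continuous_on {0..1} (\<lambda>t. integral\<^sup>L lborel (\<lambda>x. bump x *\<^sub>R h (t *\<^sub>R x)))"
      using der by (meson has_vector_derivative_continuous continuous_on_eq_continuous_within)
  qed auto
  moreover have "integrable lborel (bump :: 'a \<Rightarrow> real)"
    using integrable_bump[of "\<lambda>_::'a. 1 :: real"] by simp
  ultimately show ?thesis by simp
qed

section \<open>Pointwise bounds by weighted integrals, Bessel's inequality and the Cauchy
  estimate\<close>

lemma integral_bump_pos: "0 < integral\<^sup>L lborel (bump :: 'a::euclidean_space \<Rightarrow> real)"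
proof -
  let ?B = "cball (0::'a) (1/2)"
  have "0 < (1/2) * measure lborel ?B"
    using content_cball_pos[of "1/2" "0::'a"] by simp
  also have "\<dots> = integral\<^sup>L lborel (\<lambda>x. (1/2) * indicator ?B x)"
    by simp
  also have "\<dots> \<le> integral\<^sup>L lborel (bump :: 'a \<Rightarrow> real)"
  proof (rule integral_mono)
    show "integrable lborel (\<lambda>x. (1/2) * indicator ?B x :: real)"
      by (intro integrable_mult_right integrable_real_indicator emeasure_bounded_finite) auto
    show "integrable lborel (bump :: 'a \<Rightarrow> real)"
      using integrable_bump[of "\<lambda>_::'a. 1 :: real"] by simp
    show "1 / 2 * indicator ?B x \<le> bump x" for x :: 'a
    proof (cases "x \<in> ?B")
      case True
      then have "(norm x)\<^sup>2 \<le> (1/2)\<^sup>2" by (intro power_mono) auto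
      then show ?thesis using True by (simp add: bump_def dot_square_norm power2_eq_square)
    qed simp
  qed
  finally show ?thesis .
qed

lemma two_inner_le: "2 * (x \<bullet> y) \<le> x \<bullet> x + y \<bullet> (y :: 'a::real_inner)"
  using inner_ge_zero[of "x - y"] by (simp add: inner_diff inner_commute)

text \<open>The mean value property is used on the ball of radius \<open>e\<close> about
  \<open>y\<close>. One factor \<open>e\<close> pays for replacing the weight of that ball by the
  weight of the unit ball; the other \<open>DIM('a)\<close> factors come from the change of
  variables.\<close>

lemma harmonic_le_L2:
  fixes h :: "'a::euclidean_space \<Rightarrow> 'b::euclidean_space"
  assumes h: "C2_harmonic h D H" and e: "0 < e" "e \<le> 1" and y: "norm y \<le> 1 - 2 * e"
  shows "e ^ (DIM('a) + 1) * ((h y \<bullet> h y) * integral\<^sup>L lborel (bump :: 'a \<Rightarrow> real))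
    \<le> integral\<^sup>L lborel (\<lambda>x. bump x * (h x \<bullet> h x))"
proof -
  let ?O = "integral\<^sup>L lborel (bump :: 'a \<Rightarrow> real)"
  let ?g = "\<lambda>x. bump x * (h x \<bullet> h x)"
  note conth = C2_harmonicD(5)[OF h]
  have conthy: "continuous_on UNIV (\<lambda>z. h (y + e *\<^sub>R z))"
    by (intro continuous_intros continuous_on_compose2[OF conth]) auto
  have int1: "integrable lborel (\<lambda>z. bump z * (h (y + e *\<^sub>R z) \<bullet> h (y + e *\<^sub>R z)))"
    using integrable_bump[of "\<lambda>z. h (y + e *\<^sub>R z) \<bullet> h (y + e *\<^sub>R z)"] by (simp add: continuous_intros conthy)
  have intb: "integrable lborel (bump :: 'a \<Rightarrow> real)"
    using integrable_bump[of "\<lambda>_::'a. 1 :: real"] by simp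
  have int2: "integrable lborel (\<lambda>z. bump z *\<^sub>R h (y + e *\<^sub>R z))"
    by (rule integrable_bump[OF conthy])
  have contg: "continuous_on UNIV ?g" by (intro continuous_intros conth)
  have int3: "integrable lborel (\<lambda>z. ?g (y + e *\<^sub>R z))"
  proof (rule integrable_compact_support[where R = "(1 + norm y) / e"])
    show "continuous_on UNIV (\<lambda>z. ?g (y + e *\<^sub>R z))" by (intro continuous_intros conthy)
    fix z :: 'a assume "(1 + norm y) / e < norm z"
    then have "1 + norm y < norm (e *\<^sub>R z)" using e by (simp add: pos_divide_less_eq mult.commute)
    then have "1 < norm (y + e *\<^sub>R z)" using norm_diff_ineq[of "e *\<^sub>R z" y] by (simp add: add.commute)
    then show "?g (y + e *\<^sub>R z) = 0" by (simp add: bump_eq_0)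
  qed
  \<comment> \<open>The quadratic inequality \<open>two_inner_le\<close> returns one copy of the
    left side, which is then subtracted; this stands in for the Cauchy-Schwarz inequality for
    integrals.\<close>
  have "2 * ((h y \<bullet> h y) * ?O) = 2 * integral\<^sup>L lborel (\<lambda>z. h y \<bullet> (bump z *\<^sub>R h (y + e *\<^sub>R z)))"
    using harmonic_mean_value_0[OF C2_harmonic_affine[OF h], of y e]
    by (subst integral_inner_right[OF int2]) simp
  also have "\<dots> = integral\<^sup>L lborel (\<lambda>z. 2 * (h y \<bullet> (bump z *\<^sub>R h (y + e *\<^sub>R z))))" by simp
  also have "\<dots> \<le> integral\<^sup>L lborel (\<lambda>z. (h y \<bullet> h y) * bump z + bump z * (h (y + e *\<^sub>R z) \<bullet> h (y + e *\<^sub>R z)))"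
  proof (rule integral_mono)
    show "2 * (h y \<bullet> (bump z *\<^sub>R h (y + e *\<^sub>R z))) \<le>
        (h y \<bullet> h y) * bump z + bump z * (h (y + e *\<^sub>R z) \<bullet> h (y + e *\<^sub>R z))" for z
      using mult_left_mono[OF two_inner_le[of "h y" "h (y + e *\<^sub>R z)"] bump_nonneg[of z]]
      by (simp add: algebra_simps)
  qed (intro integrable_mult_right integrable_inner_right Bochner_Integration.integrable_add int1 int2 intb)+
  also have "\<dots> = (h y \<bullet> h y) * ?O + integral\<^sup>L lborel (\<lambda>z. bump z * (h (y + e *\<^sub>R z) \<bullet> h (y + e *\<^sub>R z)))"
    using int1 intb by simp
  finally have "(h y \<bullet> h y) * ?O \<le> integral\<^sup>L lborel (\<lambda>z. bump z * (h (y + e *\<^sub>R z) \<bullet> h (y + e *\<^sub>R z)))"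
    by linarith
  also have "\<dots> \<le> integral\<^sup>L lborel (\<lambda>z. (1 / e) * ?g (y + e *\<^sub>R z))"
  proof (rule integral_mono[OF int1 integrable_mult_right[OF int3]])
    fix z :: 'a
    \<comment> \<open>The ball of radius \<open>e\<close> about \<open>y\<close> lies in the ball of
      radius \<open>1 - e\<close>, where the weight is at least
      \<open>1 - (1 - e)\<^sup>2 = 2 * e - e\<^sup>2 \<ge> e\<close>.\<close>
    have "e * bump z \<le> bump (y + e *\<^sub>R z)"
    proof (cases "norm z \<le> 1")
      case True
      have "norm (y + e *\<^sub>R z) \<le> norm y + e * norm z" using norm_triangle_ineq[of y "e *\<^sub>R z"] e by simp
      also have "\<dots> \<le> norm y + e" using True e by (simp add: mult_left_le)
      also have "\<dots> \<le> 1 - e" using y by simp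
      finally have le: "norm (y + e *\<^sub>R z) \<le> 1 - e" .
      then have "(norm (y + e *\<^sub>R z))\<^sup>2 \<le> (1 - e)\<^sup>2" by (intro power_mono) auto
      moreover have "e * e \<le> e" using e by (simp add: mult_left_le)
      ultimately have "e \<le> bump (y + e *\<^sub>R z)"
        by (simp add: bump_def dot_square_norm power2_eq_square algebra_simps)
      moreover have "e * bump z \<le> e" using bump_le_1[of z] e by (simp add: mult_left_le)
      ultimately show ?thesis by linarith
    qed (simp add: bump_eq_0)
    then have "bump z \<le> (1 / e) * bump (y + e *\<^sub>R z)" using e by (simp add: field_simps)
    from mult_right_mono[OF this inner_ge_zero[of "h (y + e *\<^sub>R z)"]]
    show "bump z * (h (y + e *\<^sub>R z) \<bullet> h (y + e *\<^sub>R z)) \<le> (1 / e) * ?g (y + e *\<^sub>R z)"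
      by (simp add: mult.assoc)
  qed
  also have "\<dots> = (1 / e) * integral\<^sup>L lborel (\<lambda>z. ?g (y + e *\<^sub>R z))" by simp
  finally have "e * ((h y \<bullet> h y) * ?O) \<le> integral\<^sup>L lborel (\<lambda>z. ?g (y + e *\<^sub>R z))"
    using e by (simp add: field_simps)
  from mult_left_mono[OF this, of "e ^ DIM('a)"]
  show ?thesis
    using e lborel_integral_affine[of ?g e y] contg
    by (simp add: borel_measurable_continuous_onI mult.assoc mult.left_commute)
qed

text \<open>By orthogonality the weighted pairing of \<open>f (R *\<^sub>R x)\<close> with
  \<open>P q x\<close> keeps only the term of degree \<open>q\<close>. Estimating twice this
  pairing, scaled by \<open>R ^ q\<close>, with \<open>two_inner_le\<close> leaves two copies of the
  claimed left side below the claimed right side plus one copy.\<close>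

lemma homogeneous_harmonic_Bessel:
  fixes P :: "nat \<Rightarrow> 'a::euclidean_space \<Rightarrow> 'b::euclidean_space"
  assumes har: "\<And>q. C2_harmonic (P q) (D q) (H q)"
    and euler: "\<And>q x. D q x x = real q *\<^sub>R P q x"
    and hom: "\<And>q c x. P q (c *\<^sub>R x) = c ^ q *\<^sub>R P q x"
    and bound: "\<And>q x. norm x \<le> 1 \<Longrightarrow> norm (P q x) \<le> k q"
    and R: "0 < R" and summ: "summable (\<lambda>q. k q * R ^ q)"
    and f: "\<And>x. (\<lambda>q. P q x) sums f x" and M: "\<And>x. norm x \<le> R \<Longrightarrow> norm (f x) \<le> M"
  shows "R ^ q * R ^ q * integral\<^sup>L lborel (\<lambda>x. bump x * (P q x \<bullet> P q x))
    \<le> M\<^sup>2 * integral\<^sup>L lborel (bump :: 'a \<Rightarrow> real)"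
proof -
  let ?O = "integral\<^sup>L lborel (bump :: 'a \<Rightarrow> real)"
  define A where "A = integral\<^sup>L lborel (\<lambda>x. bump x * (P q x \<bullet> P q x))"
  define F where "F j x = R ^ j * (bump x * (P j x \<bullet> P q x))" for j x
  note contP = C2_harmonicD(5)[OF har]
  have k0: "0 \<le> k j" for j by (rule order_trans[OF norm_ge_zero bound[of 0]]) simp
  have intb: "integrable lborel (bump :: 'a \<Rightarrow> real)"
    using integrable_bump[of "\<lambda>_::'a. 1 :: real"] by simp
  have intPP: "integrable lborel (\<lambda>x. bump x * (P i x \<bullet> P j x))" for i j
    using integrable_bump[of "\<lambda>x. P i x \<bullet> P j x"] by (simp add: continuous_intros contP)
  then have intF: "integrable lborel (F j)" for j unfolding F_def by (rule integrable_mult_right)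
  have FF: "F j x = bump x * ((P j (R *\<^sub>R x)) \<bullet> P q x)" for j x
    by (simp add: F_def hom)
  \<comment> \<open>The bound is summable over \<open>j\<close> and integrable in \<open>x\<close>;
    it justifies exchanging the series with the integral.\<close>
  have normF: "norm (F j x) \<le> (k j * R ^ j) * k q * bump x" for j x
  proof (cases "norm x \<le> 1")
    case True
    have "\<bar>P j x \<bullet> P q x\<bar> \<le> k j * k q"
      using Cauchy_Schwarz_ineq2[of "P j x" "P q x"] mult_mono[OF bound[OF True, of j] bound[OF True, of q] k0]
      by simp
    then have "R ^ j * (bump x * \<bar>P j x \<bullet> P q x\<bar>) \<le> R ^ j * (bump x * (k j * k q))"
      using R by (intro mult_left_mono) auto
    then show ?thesis using R by (simp add: F_def abs_mult algebra_simps)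
  qed (simp add: F_def bump_eq_0)
  have sumF: "summable (\<lambda>j. norm (F j x))" for x
    by (rule summable_comparison_test[OF exI[of _ 0], of _ "\<lambda>j. (k j * R ^ j) * k q * bump x"])
      (use normF in \<open>auto intro!: summable_mult2 summ\<close>)
  have sumintF: "summable (\<lambda>j. integral\<^sup>L lborel (\<lambda>x. norm (F j x)))"
  proof (rule summable_comparison_test[OF exI[of _ 0], of _ "\<lambda>j. (k j * R ^ j) * k q * ?O"])
    have "integral\<^sup>L lborel (\<lambda>x. norm (F j x)) \<le> integral\<^sup>L lborel (\<lambda>x::'a. (k j * R ^ j) * k q * bump x)" for j
      by (rule integral_mono) (use intF intb normF in \<open>auto intro: integrable_norm\<close>)
    then show "\<forall>j\<ge>0. norm (integral\<^sup>L lborel (\<lambda>x. norm (F j x))) \<le> (k j * R ^ j) * k q * ?O"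
      by (simp add: integral_nonneg_AE)
  qed (auto intro!: summable_mult2 summ)
  have suminfF: "(\<Sum>j. F j x) = bump x * (f (R *\<^sub>R x) \<bullet> P q x)" for x
  proof -
    have "(\<lambda>j. bump x * (P j (R *\<^sub>R x) \<bullet> P q x)) sums (bump x * (f (R *\<^sub>R x) \<bullet> P q x))"
      by (intro sums_mult bounded_linear.sums[OF bounded_linear_inner_left] f)
    then show ?thesis by (simp add: FF sums_iff)
  qed
  have "(\<lambda>j. integral\<^sup>L lborel (F j)) sums integral\<^sup>L lborel (\<lambda>x. \<Sum>j. F j x)"
    by (rule sums_integral) (use intF sumF sumintF in auto)
  moreover have "integral\<^sup>L lborel (F j) = (if j = q then R ^ q * A else 0)" for j
    using harmonic_orthogonal[OF har[of j] har[of q] euler euler] by (auto simp: F_def[abs_def] A_def)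
  ultimately have "(\<lambda>j. if j = q then R ^ q * A else 0) sums integral\<^sup>L lborel (\<lambda>x. \<Sum>j. F j x)"
    by simp
  from sums_unique2[OF this sums_single[of q "\<lambda>_. R ^ q * A"]]
  have key: "integral\<^sup>L lborel (\<lambda>x. bump x * (f (R *\<^sub>R x) \<bullet> P q x)) = R ^ q * A"
    by (simp add: suminfF)
  have intf: "integrable lborel (\<lambda>x. bump x * (f (R *\<^sub>R x) \<bullet> P q x))"
  proof -
    have "integrable lborel (\<lambda>x. \<Sum>j. F j x)"
      by (rule integrable_suminf) (use intF sumF sumintF in auto)
    then show ?thesis by (simp add: suminfF)
  qed
  have "2 * R ^ q * (R ^ q * A) = integral\<^sup>L lborel (\<lambda>x. 2 * R ^ q * (bump x * (f (R *\<^sub>R x) \<bullet> P q x)))"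
    by (simp add: key)
  also have "\<dots> \<le> integral\<^sup>L lborel (\<lambda>x. M\<^sup>2 * bump x + R ^ q * R ^ q * (bump x * (P q x \<bullet> P q x)))"
  proof (rule integral_mono)
    fix x :: 'a
    show "2 * R ^ q * (bump x * (f (R *\<^sub>R x) \<bullet> P q x))
        \<le> M\<^sup>2 * bump x + R ^ q * R ^ q * (bump x * (P q x \<bullet> P q x))"
    proof (cases "norm x \<le> 1")
      case True
      then have "norm (f (R *\<^sub>R x)) \<le> M" using R by (intro M) (simp add: mult_left_le)
      then have "f (R *\<^sub>R x) \<bullet> f (R *\<^sub>R x) \<le> M\<^sup>2"
        by (simp add: dot_square_norm power_mono)
      then have "2 * (f (R *\<^sub>R x) \<bullet> (R ^ q *\<^sub>R P q x)) \<le> M\<^sup>2 + (R ^ q *\<^sub>R P q x) \<bullet> (R ^ q *\<^sub>R P q x)"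
        using two_inner_le[of "f (R *\<^sub>R x)" "R ^ q *\<^sub>R P q x"] by linarith
      from mult_left_mono[OF this bump_nonneg[of x]] show ?thesis
        by (simp add: algebra_simps)
    qed (simp add: bump_eq_0)
  qed (intro integrable_mult_right Bochner_Integration.integrable_add intf intPP intb)+
  also have "\<dots> = M\<^sup>2 * ?O + R ^ q * R ^ q * A"
    unfolding A_def using intb intPP by simp
  finally show ?thesis by (simp add: A_def)
qed

text \<open>Bessel's inequality bounds a weighted square integral, and \<open>harmonic_le_L2\<close>
  turns this into a bound at the shrunken point \<open>(1 - 2 * e) *\<^sub>R x\<close>. Homogeneity
  moves it back to \<open>x\<close> at the price of \<open>(1 - 2 * e) ^ q\<close>; the other
  constant depends only on \<open>e\<close> and the dimension.\<close>

lemma homogeneous_harmonic_Cauchy: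
  fixes P :: "nat \<Rightarrow> 'a::euclidean_space \<Rightarrow> 'b::euclidean_space"
  assumes har: "\<And>q. C2_harmonic (P q) (D q) (H q)"
    and euler: "\<And>q x. D q x x = real q *\<^sub>R P q x"
    and hom: "\<And>q c x. P q (c *\<^sub>R x) = c ^ q *\<^sub>R P q x"
    and bound: "\<And>q x. norm x \<le> 1 \<Longrightarrow> norm (P q x) \<le> k q"
    and R: "0 < R" and summ: "summable (\<lambda>q. k q * R ^ q)"
    and f: "\<And>x. (\<lambda>q. P q x) sums f x" and M: "\<And>x. norm x \<le> R \<Longrightarrow> norm (f x) \<le> M"
    and e: "0 < e" "e < 1 / 2" and x: "norm x \<le> 1"
  shows "norm (P q x) * ((1 - 2 * e) * R) ^ q \<le> sqrt (1 / e ^ (DIM('a) + 1)) * M"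
proof -
  let ?O = "integral\<^sup>L lborel (bump :: 'a \<Rightarrow> real)"
  define y where "y = (1 - 2 * e) *\<^sub>R x"
  have M0: "0 \<le> M" by (rule order_trans[OF norm_ge_zero M[of 0]]) (use R in simp)
  have "norm y \<le> 1 - 2 * e" using e x by (simp add: y_def mult_left_le)
  then have "e ^ (DIM('a) + 1) * ((P q y \<bullet> P q y) * ?O) \<le> integral\<^sup>L lborel (\<lambda>x. bump x * (P q x \<bullet> P q x))"
    using e by (intro harmonic_le_L2[OF har]) auto
  then have "R ^ q * R ^ q * (e ^ (DIM('a) + 1) * ((P q y \<bullet> P q y) * ?O)) \<le>
      R ^ q * R ^ q * integral\<^sup>L lborel (\<lambda>x. bump x * (P q x \<bullet> P q x))"
    using R by (intro mult_left_mono) auto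
  also have "\<dots> \<le> M\<^sup>2 * ?O"
    by (rule homogeneous_harmonic_Bessel[OF har euler hom bound R summ f M])
  finally have "(R ^ q * R ^ q * (e ^ (DIM('a) + 1) * (P q y \<bullet> P q y))) * ?O \<le> M\<^sup>2 * ?O"
    by (simp add: mult.assoc)
  then have "R ^ q * R ^ q * (e ^ (DIM('a) + 1) * (P q y \<bullet> P q y)) \<le> M\<^sup>2"
    using integral_bump_pos[where 'a='a] by simp
  then have "(norm (P q y) * R ^ q)\<^sup>2 \<le> (1 / e ^ (DIM('a) + 1)) * M\<^sup>2"
    using e by (simp add: dot_square_norm power_mult_distrib power2_eq_square field_simps)
  then have "norm (P q y) * R ^ q \<le> sqrt ((1 / e ^ (DIM('a) + 1)) * M\<^sup>2)"
    by (rule real_le_rsqrt)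
  then have "norm (P q y) * R ^ q \<le> sqrt (1 / e ^ (DIM('a) + 1)) * M"
    using M0 by (simp only: real_sqrt_mult real_sqrt_abs abs_of_nonneg)
  moreover have "norm (P q y) = (1 - 2 * e) ^ q * norm (P q x)"
    using e by (simp add: y_def hom)
  ultimately show ?thesis by (simp add: power_mult_distrib mult_ac)
qed

section \<open>Homogeneous parts of a Fueter series\<close>

lemma bounded_bilinear_cl_mult: "bounded_bilinear (\<odot>)"
  using bilinear_cl_mult by (simp add: bilinear_conv_bounded_bilinear)

lemmas cl_mult_sum_left = bounded_bilinear.sum_left[OF bounded_bilinear_cl_mult]
  and cl_mult_sum_right = bounded_bilinear.sum_right[OF bounded_bilinear_cl_mult]
  and cl_mult_diff_left = bounded_bilinear.diff_left[OF bounded_bilinear_cl_mult]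
  and cl_mult_diff_right = bounded_bilinear.diff_right[OF bounded_bilinear_cl_mult]
  and cl_mult_minus_left = bounded_bilinear.minus_left[OF bounded_bilinear_cl_mult]
  and cl_mult_minus_right = bounded_bilinear.minus_right[OF bounded_bilinear_cl_mult]
  and cl_mult_zero_left [simp] = bounded_bilinear.zero_left[OF bounded_bilinear_cl_mult]
  and cl_mult_zero_right [simp] = bounded_bilinear.zero_right[OF bounded_bilinear_cl_mult]
  and has_derivative_cl_mult = bounded_bilinear.FDERIV[OF bounded_bilinear_cl_mult]
  and continuous_on_cl_mult = bounded_bilinear.continuous_on[OF bounded_bilinear_cl_mult]

section \<open>Exchange relations for the Fueter variables\<close>

lemma bounded_linear_fueter_var: "bounded_linear (\<lambda>x. fueter_var x j)"
  unfolding fueter_var_def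
  by (intro bounded_linear_intros bounded_linear_compose[OF bounded_linear_vec_nth])

lemma fueter_var_scaleR: "fueter_var (t *\<^sub>R x) j = t *\<^sub>R fueter_var x j"
  by (simp add: fueter_var_def scaleR_diff_right)

text \<open>The Fueter variables do not commute in general, but their symmetrized products may
  exchange the points \<open>x\<close> and \<open>y\<close>: on expansion the only products of two
  units are \<open>e_i e_j\<close> and \<open>e_j e_i\<close>, both with coefficient
  \<open>x0 y0\<close>, which is symmetric in the two points.\<close>

lemma fueter_var_exchange:
  "fueter_var x i \<odot> fueter_var y j + fueter_var x j \<odot> fueter_var y i =
   fueter_var y i \<odot> fueter_var x j + fueter_var y j \<odot> fueter_var x i"
  by (simp add: fueter_var_def cl_mult_diff_left cl_mult_diff_right cl_mult_scaleR_left
      cl_mult_scaleR_right cl_mult_one_left cl_mult_one_right algebra_simps)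

lemma sum_symmetrize:
  fixes F :: "'i \<Rightarrow> 'i \<Rightarrow> 'a::real_vector"
  shows "2 *\<^sub>R (\<Sum>i\<in>S. \<Sum>j\<in>S. F i j) = (\<Sum>i\<in>S. \<Sum>j\<in>S. F i j + F j i)"
  using sum.swap[of "\<lambda>i j. F j i" S S] by (simp add: sum.distrib scaleR_2)

text \<open>Symmetric coefficients allow the sum to be symmetrized in \<open>i\<close> and
  \<open>j\<close>, which brings it into the form covered by
  \<open>fueter_var_exchange\<close>.\<close>

lemma fueter_var_sum_exchange:
  assumes "\<And>i j. C i j = C j i"
  shows "(\<Sum>i\<in>UNIV. \<Sum>j\<in>UNIV. fueter_var x i \<odot> (fueter_var y j \<odot> C i j)) =
    (\<Sum>i\<in>UNIV. \<Sum>j\<in>UNIV. fueter_var y i \<odot> (fueter_var x j \<odot> C i j))" (is "?l = ?r")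
proof -
  have "2 *\<^sub>R ?l = (\<Sum>i\<in>UNIV. \<Sum>j\<in>UNIV.
      (fueter_var x i \<odot> fueter_var y j + fueter_var x j \<odot> fueter_var y i) \<odot> C i j)"
    unfolding sum_symmetrize cl_mult_add_left cl_mult_assoc
    by (intro sum.cong refl arg_cong2[where f = "(+)"] arg_cong[where f = "\<lambda>v. _ \<odot> (_ \<odot> v)"] assms)
  also have "\<dots> = 2 *\<^sub>R ?r"
    unfolding sum_symmetrize
  proof (intro sum.cong refl)
    fix i j
    show "(fueter_var x i \<odot> fueter_var y j + fueter_var x j \<odot> fueter_var y i) \<odot> C i j =
        fueter_var y i \<odot> (fueter_var x j \<odot> C i j) + fueter_var y j \<odot> (fueter_var x i \<odot> C j i)"
      by (subst fueter_var_exchange) (simp only: cl_mult_add_left cl_mult_assoc assms[of j i])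
  qed
  finally show ?thesis by simp
qed

text \<open>After symmetrization the off-diagonal terms cancel by anticommutation, while each
  diagonal term contributes the square -1 of a unit.\<close>

lemma e_unit_sum_square:
  assumes "\<And>i j. C i j = C j i"
  shows "(\<Sum>i\<in>UNIV. \<Sum>j\<in>UNIV. e_unit i \<odot> (e_unit j \<odot> C i j)) = - (\<Sum>i\<in>UNIV. C i i)" (is "?l = _")
proof -
  have "2 *\<^sub>R ?l = (\<Sum>i\<in>UNIV. \<Sum>j\<in>UNIV. (e_unit i \<odot> e_unit j + e_unit j \<odot> e_unit i) \<odot> C i j)"
    unfolding sum_symmetrize cl_mult_add_left cl_mult_assoc
    by (intro sum.cong refl arg_cong2[where f = "(+)"] arg_cong[where f = "\<lambda>v. _ \<odot> (_ \<odot> v)"] assms)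
  also have "\<dots> = (\<Sum>i\<in>UNIV. \<Sum>j\<in>UNIV. if j = i then (- 2) *\<^sub>R C i j else 0)"
  proof (intro sum.cong refl)
    fix i j :: 'a
    show "(e_unit i \<odot> e_unit j + e_unit j \<odot> e_unit i) \<odot> C i j = (if j = i then (- 2) *\<^sub>R C i j else 0)"
    proof (cases "j = i")
      case True
      have "(e_unit i \<odot> e_unit i + e_unit i \<odot> e_unit i) \<odot> C i i = - (2 *\<^sub>R C i i)"
        by (simp only: e_unit_square cl_mult_minus_left cl_mult_one_left cl_mult_add_left scaleR_2 minus_add_distrib)
      with True show ?thesis by simp
    qed (simp add: e_unit_anticommute)
  qed
  also have "\<dots> = 2 *\<^sub>R (- (\<Sum>i\<in>UNIV. C i i))" by (simp add: scaleR_sum_right sum_negf)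
  finally show ?thesis by (simp only: scaleR_cancel_left) simp
qed

section \<open>Word sums, their derivatives and their harmonicity\<close>

text \<open>
  Indexing the coefficients by multisets makes them invariant under permuting the word.
\<close>

primrec word_sum ::
    "nat \<Rightarrow> ('n multiset \<Rightarrow> 'n clifford) \<Rightarrow> 'n paravec \<Rightarrow> 'n::{finite,linorder} clifford" where
  "word_sum 0 c x = c {#}"
| "word_sum (Suc q) c x = (\<Sum>j\<in>UNIV. fueter_var x j \<odot> word_sum q (\<lambda>M. c (add_mset j M)) x)"

text \<open>The product rule would put the differentiated letter at any of \<open>Suc q\<close>
  places. Since the coefficients ignore the order of the word, it can be moved to the front, so that
  all places contribute equally.\<close>

primrec word_sum_deriv ::
    "nat \<Rightarrow> ('n multiset \<Rightarrow> 'n clifford) \<Rightarrow> 'n paravec \<Rightarrow> 'n paravec \<Rightarrow> 'n::{finite,linorder} clifford" where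
  "word_sum_deriv 0 c x y = 0"
| "word_sum_deriv (Suc q) c x y =
    real (Suc q) *\<^sub>R (\<Sum>i\<in>UNIV. fueter_var y i \<odot> word_sum q (\<lambda>M. c (add_mset i M)) x)"

primrec word_sum_deriv2 ::
    "nat \<Rightarrow> ('n multiset \<Rightarrow> 'n clifford) \<Rightarrow> 'n paravec \<Rightarrow> 'n paravec \<Rightarrow> 'n paravec \<Rightarrow> 'n::{finite,linorder} clifford" where
  "word_sum_deriv2 0 c x y y' = 0"
| "word_sum_deriv2 (Suc q) c x y y' =
    real (Suc q) *\<^sub>R (\<Sum>i\<in>UNIV. fueter_var y i \<odot> word_sum_deriv q (\<lambda>M. c (add_mset i M)) x y')"

text \<open>Euler's relation: the front letter evaluated at \<open>x\<close> itself completes the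
  word sum again.\<close>

lemma word_sum_deriv_self: "word_sum_deriv q c x x = real q *\<^sub>R word_sum q c x"
  by (cases q) auto

lemma word_sum_scaleR: "word_sum q c (t *\<^sub>R x) = t ^ q *\<^sub>R word_sum q c x"
  by (induction q arbitrary: c)
    (simp_all add: fueter_var_scaleR cl_mult_scaleR_left cl_mult_scaleR_right scaleR_sum_right mult.commute)

lemma has_derivative_word_sum: "(word_sum q c has_derivative word_sum_deriv q c x) (at x)"
proof (induction q arbitrary: c)
  case 0
  then show ?case by (simp add: word_sum.simps(1)[abs_def] word_sum_deriv.simps(1)[abs_def])
next
  case (Suc q)
  have "((\<lambda>x. \<Sum>j\<in>UNIV. fueter_var x j \<odot> word_sum q (\<lambda>M. c (add_mset j M)) x) has_derivative
      (\<lambda>y. \<Sum>j\<in>UNIV. fueter_var x j \<odot> word_sum_deriv q (\<lambda>M. c (add_mset j M)) x y +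
         fueter_var y j \<odot> word_sum q (\<lambda>M. c (add_mset j M)) x)) (at x)"
    by (intro has_derivative_sum has_derivative_cl_mult Suc.IH
        bounded_linear_imp_has_derivative bounded_linear_fueter_var)
  \<comment> \<open>The induction hypothesis places the differentiated letter second; the exchange
    relation swaps it with the leading letter, so these terms supply the remaining factor
    \<open>real q\<close>.\<close>
  moreover have "(\<Sum>j\<in>UNIV. fueter_var x j \<odot> word_sum_deriv q (\<lambda>M. c (add_mset j M)) x y) =
      real q *\<^sub>R (\<Sum>j\<in>UNIV. fueter_var y j \<odot> word_sum q (\<lambda>M. c (add_mset j M)) x)" for y
  proof (cases q)
    case (Suc p)
    let ?C = "\<lambda>i j. word_sum p (\<lambda>M. c (add_mset i (add_mset j M))) x"
    have "(\<Sum>i\<in>UNIV. \<Sum>j\<in>UNIV. fueter_var x i \<odot> (fueter_var y j \<odot> ?C i j)) =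
        (\<Sum>i\<in>UNIV. \<Sum>j\<in>UNIV. fueter_var y i \<odot> (fueter_var x j \<odot> ?C i j))"
      by (rule fueter_var_sum_exchange) (simp add: add_mset_commute)
    then show ?thesis
      by (simp add: Suc cl_mult_scaleR_right cl_mult_sum_right flip: scaleR_sum_right)
  qed simp
  ultimately show ?case
    by (simp add: word_sum.simps(2)[abs_def] word_sum_deriv.simps(2)[abs_def] sum.distrib algebra_simps)
qed

lemma has_derivative_word_sum_deriv:
  "((\<lambda>x. word_sum_deriv q c x y) has_derivative word_sum_deriv2 q c x y) (at x)"
proof (cases q)
  case (Suc p)
  have "((\<lambda>x. real (Suc p) *\<^sub>R (\<Sum>i\<in>UNIV. fueter_var y i \<odot> word_sum p (\<lambda>M. c (add_mset i M)) x)) has_derivative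
     (\<lambda>y'. real (Suc p) *\<^sub>R (\<Sum>i\<in>UNIV. fueter_var y i \<odot> word_sum_deriv p (\<lambda>M. c (add_mset i M)) x y'))) (at x)"
    by (intro has_derivative_scaleR_right has_derivative_sum has_derivative_word_sum
        bounded_linear.has_derivative[OF bounded_bilinear.bounded_linear_right[OF bounded_bilinear_cl_mult]])
  then show ?thesis
    by (simp add: Suc word_sum_deriv2.simps(2)[abs_def])
qed (simp add: word_sum_deriv2.simps(1)[abs_def])

lemma continuous_on_word_sum: "continuous_on S (word_sum q c)"
  using has_derivative_word_sum
  by (meson continuous_at_imp_continuous_on has_derivative_continuous)

lemma sum_Basis_paravec:
  fixes F :: "'n::finite paravec \<Rightarrow> 'b::comm_monoid_add"
  shows "(\<Sum>b\<in>Basis. F b) = F (1, 0) + (\<Sum>k\<in>UNIV. F (0, axis k 1))"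
proof -
  have B: "(Basis :: 'n paravec set) = insert (1, 0) ((\<lambda>k. (0, axis k 1)) ` UNIV)"
    by (auto simp: Basis_prod_def Basis_vec_def)
  have inj: "inj_on (\<lambda>k. (0 :: real, axis k (1::real) :: (real, 'n) vec)) UNIV"
    by (auto simp: inj_on_def axis_eq_axis)
  show ?thesis
    unfolding B by (subst sum.insert) (auto simp: sum.reindex[OF inj])
qed

lemma fueter_var_basis:
  "fueter_var (1, 0) i = - e_unit i"
  "fueter_var (0, axis k 1) i = (if i = k then e_one else 0)"
  by (simp_all add: fueter_var_def axis_def)

text \<open>In degree at least 2 the Laplacian replaces the first two letters. The direction
  \<open>(1, 0)\<close> contributes the sum of \<open>e_i e_j C i j\<close>, which is minus the
  trace of \<open>C\<close>, and the directions \<open>(0, axis k 1)\<close> together contribute the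
  trace of \<open>C\<close>.\<close>

lemma C2_harmonic_word_sum:
  "C2_harmonic (word_sum q c) (word_sum_deriv q c) (word_sum_deriv2 q c)"
  unfolding C2_harmonic_def
proof (intro conjI allI has_derivative_word_sum has_derivative_word_sum_deriv)
  fix y y' :: "'a paravec"
  have cont: "continuous_on UNIV (\<lambda>x. word_sum_deriv q c x y)" for q and c :: "'a multiset \<Rightarrow> 'a clifford" and y
    by (cases q) (auto intro!: continuous_intros continuous_on_cl_mult continuous_on_word_sum)
  show "continuous_on UNIV (\<lambda>x. word_sum_deriv2 q c x y y')"
  proof (cases q)
    case (Suc p)
    show ?thesis
      unfolding Suc word_sum_deriv2.simps by (intro continuous_intros continuous_on_cl_mult cont)
  qed simp
next
  fix x :: "'a paravec"
  show "(\<Sum>b\<in>Basis. word_sum_deriv2 q c x b b) = 0"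
  proof (cases "q < 2")
    case True
    then have "q = 0 \<or> q = Suc 0" by auto
    then show ?thesis by auto
  next
    case False
    then obtain p where q: "q = Suc (Suc p)" by (metis add_2_eq_Suc le_Suc_ex not_less)
    define C where "C i j = word_sum p (\<lambda>M. c (add_mset i (add_mset j M))) x" for i j
    have C: "C i j = C j i" for i j by (simp add: C_def add_mset_commute)
    have H: "word_sum_deriv2 q c x b b = (real q * real (Suc p)) *\<^sub>R
        (\<Sum>i\<in>UNIV. \<Sum>j\<in>UNIV. fueter_var b i \<odot> (fueter_var b j \<odot> C i j))" for b
      by (simp add: q C_def cl_mult_scaleR_right cl_mult_sum_right flip: scaleR_sum_right)
    have delta: "(\<Sum>i\<in>UNIV. \<Sum>j\<in>UNIV. fueter_var (0, axis k 1) i \<odot> (fueter_var (0, axis k 1) j \<odot> C i j)) = C k k" for k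
    proof -
      have delta1: "(if j = k then e_one else 0) \<odot> v = (if j = k then v else 0)" for j and v :: "'a clifford"
        by (simp add: cl_mult_one_left)
      have "(\<Sum>j\<in>UNIV. fueter_var (0, axis k 1) i \<odot> (fueter_var (0, axis k 1) j \<odot> C i j)) =
          (if i = k then C k k else 0)" for i
        unfolding fueter_var_basis delta1 by (cases "i = k") simp_all
      then show ?thesis by simp
    qed
    have "(\<Sum>b\<in>Basis. word_sum_deriv2 q c x b b) = (real q * real (Suc p)) *\<^sub>R
      ((\<Sum>i\<in>UNIV. \<Sum>j\<in>UNIV. e_unit i \<odot> (e_unit j \<odot> C i j)) + (\<Sum>k\<in>UNIV. C k k))"
      unfolding H sum_Basis_paravec delta
      by (simp add: fueter_var_basis(1) cl_mult_minus_left cl_mult_minus_right scaleR_add_right flip: scaleR_sum_right)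
    also have "\<dots> = 0" by (simp add: e_unit_sum_square[OF C])
    finally show ?thesis .
  qed
qed

section \<open>Regrouping words into Fueter polynomials\<close>

abbreviation words :: "('n \<Rightarrow> nat) \<Rightarrow> 'n list set" where
  "words m \<equiv> {js. \<forall>i. count_list js i = m i}"

lemma length_words: "js \<in> words m \<Longrightarrow> length js = mdegree m" for m :: "'n::finite \<Rightarrow> nat"
  using sum_count_set[of js UNIV] by (simp add: mdegree_def)

lemma finite_words_length: "finite {js :: 'n::finite list. length js = q}"
  using finite_lists_length_eq[of "UNIV :: 'n set" q] by simp

lemma finite_mdegree_eq: "finite {m :: 'n::finite \<Rightarrow> nat. mdegree m = q}"
proof (rule finite_subset)
  show "{m. mdegree m = q} \<subseteq> PiE (UNIV :: 'n set) (\<lambda>_. {..q})"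
    by (auto simp: mdegree_def intro!: member_le_sum)
qed (auto intro: finite_PiE)

text \<open>Unfolds the recursion into a single sum over words, the form in which words can be
  grouped by their letter counts.\<close>

lemma word_sum_eq:
  "word_sum q c x = (\<Sum>js\<in>{js. length js = q}.
     foldr (\<odot>) (map (fueter_var x) js) e_one \<odot> c (mset js))"
proof (induction q arbitrary: c)
  case (Suc q)
  have inj: "inj_on (\<lambda>(j, js). j # js) (UNIV \<times> {js :: 'a list. length js = q})"
    by (auto simp: inj_on_def)
  have img: "{js :: 'a list. length js = Suc q} = (\<lambda>(j, js). j # js) ` (UNIV \<times> {js. length js = q})"
    by (auto simp: length_Suc_conv image_iff)
  show ?case
    unfolding img sum.reindex[OF inj]
    by (simp add: Suc.IH sum.cartesian_product split_beta cl_mult_sum_right cl_mult_assoc)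
qed (simp add: cl_mult_one_left)

definition homogeneous_part ::
    "(('n \<Rightarrow> nat) \<Rightarrow> 'n clifford) \<Rightarrow> nat \<Rightarrow> 'n paravec \<Rightarrow> 'n::{finite,linorder} clifford" where
  "homogeneous_part a q x = (\<Sum>m\<in>{m. mdegree m = q}. fueter_poly m x \<odot> a m)"

text \<open>The normalizing factor of \<open>fueter_poly\<close> is absorbed into the coefficient,
  which leaves bare products of Fueter variables.\<close>

definition word_coeff ::
    "(('n \<Rightarrow> nat) \<Rightarrow> 'n clifford) \<Rightarrow> 'n multiset \<Rightarrow> 'n::{finite,linorder} clifford" where
  "word_coeff a M = (mfact (count M) / fact (mdegree (count M))) *\<^sub>R a (count M)"

text \<open>Every word of length \<open>q\<close> belongs to exactly one multi-index of degree
  \<open>q\<close>, its letter count. The identity transfers Euler's relation, homogeneity and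
  harmonicity from word sums to the homogeneous parts.\<close>

lemma homogeneous_part_eq_word_sum: "homogeneous_part a q = word_sum q (word_coeff a)"
proof
  fix x :: "'a paravec"
  let ?w = "\<lambda>js. foldr (\<odot>) (map (fueter_var x) js) e_one"
  have eq: "{js \<in> {js. length js = q}. count_list js = m} = words m" if "mdegree m = q" for m :: "'a \<Rightarrow> nat"
    using length_words[of _ m] that by (auto simp: fun_eq_iff)
  have "homogeneous_part a q x = (\<Sum>m\<in>{m. mdegree m = q}. \<Sum>js\<in>words m. ?w js \<odot> word_coeff a (mset js))"
    unfolding homogeneous_part_def
  proof (rule sum.cong[OF refl])
    fix m :: "'a \<Rightarrow> nat" assume m: "m \<in> {m. mdegree m = q}"
    have coeff: "(mfact m / fact (mdegree m)) *\<^sub>R a m = word_coeff a (mset js)" if "js \<in> words m" for js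
    proof -
      have "count (mset js) = m" using that by (auto simp: fun_eq_iff count_mset)
      then show ?thesis by (simp add: word_coeff_def)
    qed
    have "fueter_poly m x \<odot> a m = (\<Sum>js\<in>words m. ?w js \<odot> ((mfact m / fact (mdegree m)) *\<^sub>R a m))"
      by (simp add: fueter_poly_def cl_mult_scaleR_left cl_mult_scaleR_right cl_mult_sum_left scaleR_sum_right)
    also have "\<dots> = (\<Sum>js\<in>words m. ?w js \<odot> word_coeff a (mset js))"
      by (intro sum.cong refl) (simp only: coeff)
    finally show "fueter_poly m x \<odot> a m = (\<Sum>js\<in>words m. ?w js \<odot> word_coeff a (mset js))" .
  qed
  also have "\<dots> = (\<Sum>m\<in>{m. mdegree m = q}. \<Sum>js\<in>{js \<in> {js. length js = q}. count_list js = m}.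
      ?w js \<odot> word_coeff a (mset js))"
    using eq by (intro sum.cong refl) auto
  also have "\<dots> = (\<Sum>js\<in>{js. length js = q}. ?w js \<odot> word_coeff a (mset js))"
    by (rule sum.group[OF finite_words_length finite_mdegree_eq]) (auto simp: mdegree_def sum_count_set)
  finally show "homogeneous_part a q x = word_sum q (word_coeff a) x"
    by (simp add: word_sum_eq)
qed

text \<open>The number of words is a multinomial coefficient, so the value is 1. It is kept as a
  symbol because it enters the diagonal evaluation and the general upper bound in the same
  way.\<close>

definition word_weight :: "('n::{finite,linorder} \<Rightarrow> nat) \<Rightarrow> real" where
  "word_weight m = mfact m / fact (mdegree m) * card (words m)"

lemma word_weight_nonneg: "0 \<le> word_weight m"
  by (simp add: word_weight_def mfact_def prod_nonneg)

text \<open>On the diagonal of the hyperplane \<open>x0 = 0\<close> all the variables \<open>z_j\<close> equal the same scalar.\<close>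

lemma fueter_poly_diagonal:
  "fueter_poly m (0, \<chi> i. t) \<odot> v = (word_weight m * t ^ mdegree m) *\<^sub>R v"
proof -
  have "foldr (\<odot>) (map (fueter_var (0, \<chi> i. t)) js) e_one = t ^ length js *\<^sub>R e_one" for js :: "'a list"
    by (induction js) (simp_all add: fueter_var_def cl_mult_scaleR_left cl_mult_one_left)
  then have "foldr (\<odot>) (map (fueter_var (0, \<chi> i. t)) js) e_one = t ^ mdegree m *\<^sub>R e_one"
    if "js \<in> words m" for js
    using length_words[OF that] by simp
  then have "(\<Sum>js\<in>words m. foldr (\<odot>) (map (fueter_var (0, \<chi> i. t)) js) e_one) =
      (\<Sum>js\<in>words m. t ^ mdegree m *\<^sub>R e_one)"
    by (rule sum.cong[OF refl])
  also have "\<dots> = (real (card (words m)) * t ^ mdegree m) *\<^sub>R e_one"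
    by (simp only: sum_constant_scaleR scaleR_scaleR)
  finally show ?thesis
    by (simp add: fueter_poly_def word_weight_def cl_mult_scaleR_left cl_mult_one_left)
qed

text \<open>Each letter costs at most \<open>2 * norm x\<close>, and each Clifford product costs the
  constant \<open>B\<close>, since the norm need not be submultiplicative. The resulting bound is
  the norm of the diagonal value at \<open>t = L * norm x\<close>.\<close>

lemma fueter_poly_bound:
  obtains L where "0 < L" "\<And>(m :: 'n::{finite,linorder} \<Rightarrow> nat) x v.
    norm (fueter_poly m x \<odot> v) \<le> word_weight m * (L * norm x) ^ mdegree m * norm v"
proof -
  obtain B where B: "0 < B" "\<And>u v :: 'n clifford. norm (u \<odot> v) \<le> norm u * norm v * B"
    using bounded_bilinear.pos_bounded[OF bounded_bilinear_cl_mult] by blast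
  have z: "norm (fueter_var x j) \<le> 2 * norm x" for x :: "'n paravec" and j
  proof -
    have "norm (fueter_var x j) \<le> \<bar>snd x $ j\<bar> + \<bar>fst x\<bar>"
      unfolding fueter_var_def
      by (rule order_trans[OF norm_triangle_ineq4]) (simp add: e_one_def e_unit_def e_basis_def)
    also have "\<dots> \<le> norm x + norm x"
      using component_le_norm_cart[of "snd x" j] norm_snd_le[of "snd x" "fst x"]
        norm_fst_le[of "fst x" "snd x"] by (intro add_mono) auto
    finally show ?thesis by simp
  qed
  have w: "norm (foldr (\<odot>) (map (fueter_var x) js) e_one \<odot> v) \<le> (2 * B * norm x) ^ length js * norm v"
    for x :: "'n paravec" and js v
  proof (induction js)
    case (Cons j js)
    let ?u = "foldr (\<odot>) (map (fueter_var x) js) e_one \<odot> v"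
    have "norm (fueter_var x j \<odot> ?u) \<le> norm (fueter_var x j) * norm ?u * B" by (rule B)
    also have "\<dots> \<le> (2 * norm x) * ((2 * B * norm x) ^ length js * norm v) * B"
      using B(1) z Cons.IH by (intro mult_right_mono mult_mono) auto
    finally show ?case by (simp add: cl_mult_assoc mult_ac)
  qed (simp add: cl_mult_one_left)
  have "norm (fueter_poly m x \<odot> v) \<le> word_weight m * (2 * B * norm x) ^ mdegree m * norm v"
    for m :: "'n \<Rightarrow> nat" and x v
  proof -
    have "norm (\<Sum>js\<in>words m. foldr (\<odot>) (map (fueter_var x) js) e_one \<odot> v) \<le>
        (\<Sum>js\<in>words m. (2 * B * norm x) ^ mdegree m * norm v)"
    proof (rule sum_norm_le)
      fix js assume "js \<in> words m"
      then show "norm (foldr (\<odot>) (map (fueter_var x) js) e_one \<odot> v) \<le> (2 * B * norm x) ^ mdegree m * norm v"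
        using w[of x js v] by (simp only: length_words)
    qed
    then have "norm (\<Sum>js\<in>words m. foldr (\<odot>) (map (fueter_var x) js) e_one \<odot> v) \<le>
        card (words m) * ((2 * B * norm x) ^ mdegree m * norm v)" by simp
    moreover have mf: "0 \<le> mfact m" by (simp add: mfact_def prod_nonneg)
    ultimately have "(mfact m / fact (mdegree m)) * norm (\<Sum>js\<in>words m. foldr (\<odot>) (map (fueter_var x) js) e_one \<odot> v) \<le>
       (mfact m / fact (mdegree m)) * (card (words m) * ((2 * B * norm x) ^ mdegree m * norm v))"
      by (intro mult_left_mono) auto
    then show ?thesis
      using mf by (simp add: fueter_poly_def word_weight_def cl_mult_scaleR_left cl_mult_sum_left mult.assoc)
  qed
  then show ?thesis using that[of "2 * B"] B by simp
qed

text \<open>An unconditional sum may be taken over pairs of a degree and a multi-index of that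
  degree; the inner sums are finite, and what remains is an ordinary series.\<close>

lemma has_sum_imp_sums_by_degree:
  fixes g :: "('n::finite \<Rightarrow> nat) \<Rightarrow> 'b::{topological_comm_monoid_add,t3_space}"
  assumes "(g has_sum s) UNIV"
  shows "(\<lambda>q. \<Sum>m\<in>{m. mdegree m = q}. g m) sums s"
proof -
  have bij: "bij_betw (\<lambda>p. snd p) (SIGMA q:UNIV. {m :: 'n \<Rightarrow> nat. mdegree m = q}) UNIV"
    by (auto simp: bij_betw_def inj_on_def image_iff)
  have "((\<lambda>p. g (snd p)) has_sum s) (SIGMA q:UNIV. {m. mdegree m = q})"
    using assms has_sum_reindex_bij_betw[OF bij] by blast
  then have "((\<lambda>q. \<Sum>m\<in>{m. mdegree m = q}. g m) has_sum s) UNIV"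
    by (rule has_sum_SigmaD) (simp add: finite_mdegree_eq has_sum_finite)
  then show ?thesis by (rule has_sum_imp_sums)
qed

text \<open>In finite dimension unconditional convergence is absolute: it is so for each real
  component, and the norm is at most the sum of the absolute components.\<close>

lemma abs_summable_euclidean:
  fixes g :: "'i \<Rightarrow> (real, 'k::finite) vec"
  assumes "g summable_on A"
  shows "(\<lambda>i. norm (g i)) summable_on A"
proof -
  have "(\<lambda>i. g i $ k) summable_on A" for k
    using summable_on_bounded_linear[OF bounded_linear_vec_nth assms] by simp
  then have "(\<lambda>i. \<bar>g i $ k\<bar>) summable_on A" for k
    using summable_on_iff_abs_summable_on_real[of "\<lambda>i. g i $ k" A for k] by (simp only: real_norm_def)
  then have "(\<lambda>i. \<Sum>k\<in>K. \<bar>g i $ k\<bar>) summable_on A" for K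
    by (induction K rule: infinite_finite_induct) (auto intro: summable_on_add)
  then show ?thesis
    by (rule summable_on_comparison_test) (auto intro: norm_le_l1_cart)
qed

section \<open>Majorants and Cauchy estimates for a convergent Fueter series\<close>

context
  fixes f :: "'n paravec \<Rightarrow> 'n::{finite,linorder} clifford" and a :: "('n \<Rightarrow> nat) \<Rightarrow> 'n clifford"
  assumes has_sum: "\<And>x. ((\<lambda>m. fueter_poly m x \<odot> a m) has_sum f x) UNIV"
begin

lemma homogeneous_part_sums: "(\<lambda>q. homogeneous_part a q x) sums f x"
  using has_sum_imp_sums_by_degree[OF has_sum[of x]] by (simp add: homogeneous_part_def)

text \<open>Convergence at diagonal points alone yields absolute convergence of the scalar majorant
  series at every radius. This permits termwise integration and makes the suprema
  \<open>homogeneous_sup\<close> finite.\<close>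

lemma homogeneous_part_majorant:
  obtains k where "\<And>q x. norm x \<le> 1 \<Longrightarrow> norm (homogeneous_part a q x) \<le> k q"
    "\<And>R. 0 \<le> R \<Longrightarrow> summable (\<lambda>q. k q * R ^ q)"
proof -
  obtain L where L: "0 < L" "\<And>(m :: 'n \<Rightarrow> nat) x v.
    norm (fueter_poly m x \<odot> v) \<le> word_weight m * (L * norm x) ^ mdegree m * norm v"
    using fueter_poly_bound by blast
  define k where "k q = (\<Sum>m\<in>{m. mdegree m = q}. word_weight m * L ^ mdegree m * norm (a m))" for q
  have "norm (homogeneous_part a q x) \<le> k q" if "norm x \<le> 1" for q x
    unfolding homogeneous_part_def k_def
  proof (rule sum_norm_le)
    fix m :: "'n \<Rightarrow> nat"
    have "(L * norm x) ^ mdegree m \<le> L ^ mdegree m"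
      using L that by (intro power_mono) (auto simp: mult_left_le)
    then have "word_weight m * (L * norm x) ^ mdegree m * norm (a m) \<le> word_weight m * L ^ mdegree m * norm (a m)"
      by (intro mult_right_mono mult_left_mono word_weight_nonneg) auto
    then show "norm (fueter_poly m x \<odot> a m) \<le> word_weight m * L ^ mdegree m * norm (a m)"
      using L(2)[of m x "a m"] by linarith
  qed
  moreover have "summable (\<lambda>q. k q * R ^ q)" if "0 \<le> R" for R
  proof -
    let ?g = "\<lambda>m :: 'n \<Rightarrow> nat. word_weight m * (L * R) ^ mdegree m * norm (a m)"
    \<comment> \<open>The diagonal parameter \<open>L * R\<close> makes each norm equal to the
      majorant of \<open>fueter_poly_bound\<close> at radius \<open>R\<close>.\<close>
    have "(\<lambda>m. norm (fueter_poly m (0, \<chi> i. L * R) \<odot> a m)) summable_on UNIV"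
      using has_sum by (intro abs_summable_euclidean) (auto simp: summable_on_def)
    then have "?g summable_on UNIV"
      using L that by (simp add: fueter_poly_diagonal word_weight_nonneg)
    then obtain s where "(?g has_sum s) UNIV" by (auto simp: summable_on_def)
    from has_sum_imp_sums_by_degree[OF this]
    have "summable (\<lambda>q. \<Sum>m\<in>{m. mdegree m = q}. ?g m)" by (rule sums_summable)
    moreover have "(\<Sum>m\<in>{m. mdegree m = q}. ?g m) = k q * R ^ q" for q
      unfolding k_def sum_distrib_right by (intro sum.cong refl) (auto simp: power_mult_distrib)
    ultimately show ?thesis by simp
  qed
  ultimately show ?thesis using that by blast
qed

lemma homogeneous_sup_eq: "homogeneous_sup a q = (SUP x\<in>cball 0 1. norm (homogeneous_part a q x))"
  by (simp add: homogeneous_sup_def homogeneous_part_def)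

lemma bdd_above_homogeneous_part: "bdd_above ((\<lambda>x. norm (homogeneous_part a q x)) ` cball 0 1)"
proof -
  obtain k where "\<And>q x. norm x \<le> 1 \<Longrightarrow> norm (homogeneous_part a q x) \<le> k q"
    using homogeneous_part_majorant by metis
  then show ?thesis by (intro bdd_aboveI[of _ "k q"]) auto
qed

lemma homogeneous_sup_nonneg: "0 \<le> homogeneous_sup a q"
  unfolding homogeneous_sup_eq
  by (rule cSUP_upper2[OF bdd_above_homogeneous_part, of 0]) auto

lemma norm_homogeneous_part_le: "norm (homogeneous_part a q x) \<le> homogeneous_sup a q * norm x ^ q"
proof -
  have le: "norm (homogeneous_part a q y) \<le> homogeneous_sup a q" if "norm y \<le> 1" for y
    unfolding homogeneous_sup_eq using that by (intro cSUP_upper bdd_above_homogeneous_part) auto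
  show ?thesis
  proof (cases "x = 0")
    \<comment> \<open>The origin cannot be normalized. In degree 0 the bound is the one on the unit
      ball because \<open>0 ^ 0 = 1\<close>; in positive degree homogeneity with factor 0 gives the
      value 0.\<close>
    case True
    then show ?thesis using le[of 0] word_sum_scaleR[of q "word_coeff a" 0 0]
      by (cases q) (auto simp: homogeneous_part_eq_word_sum)
  next
    case False
    have "homogeneous_part a q x = norm x ^ q *\<^sub>R homogeneous_part a q ((1 / norm x) *\<^sub>R x)"
      using False by (simp add: homogeneous_part_eq_word_sum flip: word_sum_scaleR)
    then have "norm (homogeneous_part a q x) = norm x ^ q * norm (homogeneous_part a q ((1 / norm x) *\<^sub>R x))"
      by simp
    also have "\<dots> \<le> norm x ^ q * homogeneous_sup a q"
      using False by (intro mult_left_mono le) auto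
    finally show ?thesis by (simp add: mult.commute)
  qed
qed

lemma summable_homogeneous_sup:
  assumes "0 \<le> R"
  shows "summable (\<lambda>q. homogeneous_sup a q * R ^ q)"
proof -
  obtain k where k: "\<And>q x. norm x \<le> 1 \<Longrightarrow> norm (homogeneous_part a q x) \<le> k q"
    "summable (\<lambda>q. k q * R ^ q)"
    using homogeneous_part_majorant assms by metis
  have "homogeneous_sup a q \<le> k q" for q
    unfolding homogeneous_sup_eq by (rule cSUP_least) (auto intro: k)
  then show ?thesis
    using assms homogeneous_sup_nonneg
    by (intro summable_comparison_test[OF _ k(2)] exI[of _ 0]) (auto intro!: mult_right_mono)
qed

lemma norm_le_suminf_homogeneous_sup:
  assumes "norm x \<le> R"
  shows "norm (f x) \<le> (\<Sum>q. homogeneous_sup a q * R ^ q)"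
proof -
  have R: "0 \<le> R" using assms norm_ge_zero order_trans by blast
  have le: "norm (homogeneous_part a q x) \<le> homogeneous_sup a q * R ^ q" for q
    using norm_homogeneous_part_le[of q x] assms homogeneous_sup_nonneg[of q]
    by (meson mult_left_mono norm_ge_zero order_trans power_mono)
  have "norm (\<Sum>q. homogeneous_part a q x) \<le> (\<Sum>q. homogeneous_sup a q * R ^ q)"
    by (rule norm_suminf_le[OF le summable_homogeneous_sup[OF R]])
  then show ?thesis using homogeneous_part_sums[of x] by (simp add: sums_iff)
qed

text \<open>The counterpart of \<open>norm_le_suminf_homogeneous_sup\<close>. The constant in front
  of \<open>M\<close> is independent of \<open>q\<close> and \<open>R\<close>, so the radius may
  later vary with \<open>q\<close>.\<close>

lemma homogeneous_sup_Cauchy: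
  assumes "0 < e" "e < 1 / 2" "0 < R" and M: "\<And>x. norm x \<le> R \<Longrightarrow> norm (f x) \<le> M"
  shows "homogeneous_sup a q * ((1 - 2 * e) * R) ^ q \<le> sqrt (1 / e ^ (DIM('n paravec) + 1)) * M"
proof -
  obtain k where k: "\<And>q x. norm x \<le> 1 \<Longrightarrow> norm (homogeneous_part a q x) \<le> k q"
    "summable (\<lambda>q. k q * R ^ q)"
    using homogeneous_part_majorant assms(3) by (metis less_imp_le)
  let ?C = "sqrt (1 / e ^ (DIM('n paravec) + 1)) * M"
  have pos: "0 < ((1 - 2 * e) * R) ^ q" using assms by simp
  have "norm (homogeneous_part a q x) * ((1 - 2 * e) * R) ^ q \<le> ?C" if "norm x \<le> 1" for x
  proof (rule homogeneous_harmonic_Cauchy[where P = "homogeneous_part a" and f = f and k = k and R = R])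
    show "C2_harmonic (homogeneous_part a q) (word_sum_deriv q (word_coeff a)) (word_sum_deriv2 q (word_coeff a))" for q
      unfolding homogeneous_part_eq_word_sum by (rule C2_harmonic_word_sum)
  qed (use assms that k homogeneous_part_sums in
      \<open>simp_all add: word_sum_deriv_self word_sum_scaleR homogeneous_part_eq_word_sum\<close>)
  then have "homogeneous_sup a q \<le> ?C / ((1 - 2 * e) * R) ^ q"
    unfolding homogeneous_sup_eq
    by (intro cSUP_least) (auto simp: pos_le_divide_eq[OF pos])
  then show ?thesis by (simp add: pos_le_divide_eq[OF pos])
qed

end

section \<open>Growth and coefficients for a proximate order\<close>

text \<open>The derivative of \<open>\<rho> r * ln r\<close> with respect to \<open>ln r\<close> is
  \<open>deriv \<rho> r * r * ln r + \<rho> r\<close>, which tends to \<open>\<rho>0\<close>. Beyond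
  some \<open>R\<close> this slope stays within \<open>d\<close> of \<open>\<rho>0\<close>, so
  subtracting \<open>(\<rho>0 - d) * ln r\<close> or \<open>(\<rho>0 + d) * ln r\<close> leaves a
  monotone function. The disjunction covers both orders of \<open>r\<close> and
  \<open>s\<close>.\<close>

lemma proximate_order_Potter:
  assumes "proximate_order \<rho> \<rho>0" and "0 < d"
  obtains R where "1 \<le> R" "\<And>r s. R \<le> r \<Longrightarrow> R \<le> s \<Longrightarrow>
    s powr \<rho> s \<le> r powr \<rho> r * (s / r) powr (\<rho>0 - d) \<or> s powr \<rho> s \<le> r powr \<rho> r * (s / r) powr (\<rho>0 + d)"
proof -
  have lim: "((\<lambda>r. deriv \<rho> r * r * ln r + \<rho> r) \<longlongrightarrow> 0 + \<rho>0) at_top"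
    using assms(1) unfolding proximate_order_def by (intro tendsto_add) auto
  have "\<forall>\<^sub>F r in at_top. \<rho>0 - d < deriv \<rho> r * r * ln r + \<rho> r \<and> deriv \<rho> r * r * ln r + \<rho> r < \<rho>0 + d"
    using order_tendstoD[OF lim, of "\<rho>0 - d"] order_tendstoD[OF lim, of "\<rho>0 + d"] assms(2)
    by (auto intro: eventually_conj)
  then obtain R0 where R0: "\<And>r. R0 \<le> r \<Longrightarrow>
      \<rho>0 - d < deriv \<rho> r * r * ln r + \<rho> r \<and> deriv \<rho> r * r * ln r + \<rho> r < \<rho>0 + d"
    by (auto simp: eventually_at_top_linorder)
  define R where "R = max 1 R0"
  have der: "((\<lambda>r. \<rho> r * ln r - c * ln r) has_real_derivative (deriv \<rho> r * r * ln r + \<rho> r - c) / r) (at r)"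
    if "R \<le> r" for r c
  proof -
    have r: "0 < r" using that by (simp add: R_def)
    have "\<rho> differentiable at r within {0..}"
      using assms(1) r by (auto simp: proximate_order_def differentiable_on_def)
    moreover have "at r within {0..} = at r" using r by (intro at_within_interior) simp
    ultimately have "\<rho> differentiable at r" by simp
    then have "(\<rho> has_real_derivative deriv \<rho> r) (at r)"
      by (simp add: DERIV_deriv_iff_real_differentiable)
    then show ?thesis
      using r by (auto intro!: derivative_eq_intros simp: field_simps)
  qed
  have lo: "(\<rho>0 - d) * (ln s - ln r) \<le> \<rho> s * ln s - \<rho> r * ln r" if "R \<le> r" "r \<le> s" for r s
  proof -
    have "\<rho> r * ln r - (\<rho>0 - d) * ln r \<le> \<rho> s * ln s - (\<rho>0 - d) * ln s"
    proof (rule DERIV_nonneg_imp_nondecreasing[OF that(2)])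
      fix x assume "r \<le> x" "x \<le> s"
      then have x: "R \<le> x" using that by simp
      then have "0 \<le> (deriv \<rho> x * x * ln x + \<rho> x - (\<rho>0 - d)) / x"
        using R0[of x] by (intro divide_nonneg_pos) (auto simp: R_def)
      then show "\<exists>y. ((\<lambda>r. \<rho> r * ln r - (\<rho>0 - d) * ln r) has_real_derivative y) (at x) \<and> 0 \<le> y"
        using der[OF x] by blast
    qed
    then show ?thesis by (simp add: algebra_simps)
  qed
  have hi: "\<rho> s * ln s - \<rho> r * ln r \<le> (\<rho>0 + d) * (ln s - ln r)" if "R \<le> r" "r \<le> s" for r s
  proof -
    have "\<rho> s * ln s - (\<rho>0 + d) * ln s \<le> \<rho> r * ln r - (\<rho>0 + d) * ln r"
    proof (rule DERIV_nonpos_imp_nonincreasing[OF that(2)])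
      fix x assume "r \<le> x" "x \<le> s"
      then have x: "R \<le> x" using that by simp
      then have "(deriv \<rho> x * x * ln x + \<rho> x - (\<rho>0 + d)) / x \<le> 0"
        using R0[of x] by (intro divide_nonpos_pos) (auto simp: R_def)
      then show "\<exists>y. ((\<lambda>r. \<rho> r * ln r - (\<rho>0 + d) * ln r) has_real_derivative y) (at x) \<and> y \<le> 0"
        using der[OF x] by blast
    qed
    then show ?thesis by (simp add: algebra_simps)
  qed
  have conv: "s powr \<rho> s \<le> r powr \<rho> r * (s / r) powr p"
    if "R \<le> r" "R \<le> s" "\<rho> s * ln s - \<rho> r * ln r \<le> p * (ln s - ln r)" for r s p
  proof -
    have "0 < r" "0 < s" using that by (auto simp: R_def)
    then have "r powr \<rho> r * (s / r) powr p = exp (\<rho> r * ln r + p * (ln s - ln r))"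
      by (simp add: powr_def exp_add ln_div)
    with that(3) \<open>0 < s\<close> show ?thesis by (simp add: powr_def)
  qed
  show ?thesis
  proof (rule that[of R])
    fix r s assume rs: "R \<le> r" "R \<le> s"
    show "s powr \<rho> s \<le> r powr \<rho> r * (s / r) powr (\<rho>0 - d) \<or> s powr \<rho> s \<le> r powr \<rho> r * (s / r) powr (\<rho>0 + d)"
    proof (cases "r \<le> s")
      case True
      then show ?thesis using conv[OF rs hi[OF rs(1)]] by blast
    next
      case False
      then have "\<rho> s * ln s - \<rho> r * ln r \<le> (\<rho>0 - d) * (ln s - ln r)"
        using lo[OF rs(2), of r] by (simp add: algebra_simps)
      then show ?thesis using conv[OF rs] by blast
    qed
  qed (simp add: R_def)
qed

text \<open>The right side is the maximum over \<open>u\<close>, attained at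
  \<open>u = B * exp (- 1 / p)\<close>. With \<open>t = (u / B) powr p\<close> it reduces to
  \<open>- t * ln t \<le> 1 / exp 1\<close>.\<close>

lemma powr_times_ln_le:
  fixes B u p :: real
  assumes "0 < B" "0 < u" "0 < p"
  shows "u powr p * ln (B / u) \<le> B powr p / (exp 1 * p)"
proof -
  define t where "t = (u / B) powr p"
  have t: "0 < t" using assms by (simp add: t_def)
  have "ln (1 / (exp 1 * t)) \<le> 1 / (exp 1 * t) - 1" using t by (intro ln_le_minus_one) simp
  then have "- ln t \<le> 1 / (exp 1 * t)" using t by (simp add: ln_div ln_mult)
  from mult_left_mono[OF this, of t] have *: "t * (- ln t) \<le> 1 / exp 1"
    using t by (simp add: field_simps)
  have "ln t = - p * ln (B / u)" using assms by (simp add: t_def ln_powr ln_div algebra_simps)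
  with * have "p * (t * ln (B / u)) \<le> 1 / exp 1" by (simp add: mult_ac)
  then have "t * ln (B / u) \<le> 1 / (exp 1 * p)" using assms by (simp add: field_simps)
  from mult_left_mono[OF this, of "B powr p"] show ?thesis
    using assms by (simp add: t_def powr_divide)
qed

text \<open>Provides one \<open>d\<close> for which a strict inequality at \<open>\<rho>0\<close>
  survives at both exponents \<open>\<rho>0 - d\<close> and \<open>\<rho>0 + d\<close> of the Potter
  bounds.\<close>

lemma both_sides_less:
  fixes F :: "real \<Rightarrow> real"
  assumes "isCont F x" "F x < A" "0 < x"
  obtains d where "0 < d" "d < x" "F (x - d) < A" "F (x + d) < A"
proof -
  have "((\<lambda>d. F (x - d)) \<longlongrightarrow> F (x - 0)) (at 0)" "((\<lambda>d. F (x + d)) \<longlongrightarrow> F (x + 0)) (at 0)"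
    by (rule isCont_tendsto_compose[of _ F]; use assms(1) in \<open>auto intro!: tendsto_eq_intros\<close>)+
  then have "((\<lambda>d. F (x - d)) \<longlongrightarrow> F x) (at_right 0)" "((\<lambda>d. F (x + d)) \<longlongrightarrow> F x) (at_right 0)"
    by (auto intro: tendsto_within_subset)
  from order_tendstoD(2)[OF this(1) assms(2)] order_tendstoD(2)[OF this(2) assms(2)]
    eventually_at_right_real[OF assms(3)]
  have "\<forall>\<^sub>F d in at_right 0. 0 < d \<and> d < x \<and> F (x - d) < A \<and> F (x + d) < A"
    by eventually_elim auto
  then show ?thesis using that eventually_happens'[OF trivial_limit_at_right_real] by blast
qed

lemma proximate_order_powr_ge:
  assumes "proximate_order \<rho> \<rho>0" "0 < \<rho>0"
  shows "\<forall>\<^sub>F r in at_top. r powr (\<rho>0 / 2) \<le> r powr \<rho> r"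
proof -
  have "(\<rho> \<longlongrightarrow> \<rho>0) at_top" using assms by (simp add: proximate_order_def)
  then have "\<forall>\<^sub>F r in at_top. \<rho>0 / 2 < \<rho> r" by (rule order_tendstoD) (use assms(2) in simp)
  then show ?thesis using eventually_ge_at_top[of 1] by eventually_elim (auto intro: powr_mono)
qed

lemma proximate_order_absorb_polynomial:
  assumes "proximate_order \<rho> \<rho>0" "0 < \<rho>0" "0 < A"
  shows "\<forall>\<^sub>F r in at_top. C * r ^ N \<le> exp (A * r powr \<rho> r)"
proof -
  have "\<forall>\<^sub>F r in at_top. \<bar>C\<bar> * r ^ N \<le> exp (A * r powr (\<rho>0 / 2))"
    using assms(2,3) by real_asymp
  with proximate_order_powr_ge[OF assms(1,2)] eventually_ge_at_top[of 0]
  show ?thesis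
  proof eventually_elim
    case (elim r)
    have "C * r ^ N \<le> \<bar>C\<bar> * r ^ N" using elim by (intro mult_right_mono) auto
    also have "\<dots> \<le> exp (A * r powr (\<rho>0 / 2))" using elim by simp
    also have "\<dots> \<le> exp (A * r powr \<rho> r)" using elim assms(3) by simp
    finally show ?case .
  qed
qed

text \<open>The Potter bounds express \<open>q\<close> through \<open>r\<close> and
  \<open>\<phi> q / r\<close>, after which each large term of the series is maximized by
  \<open>powr_times_ln_le\<close>. The gap between \<open>b\<close> and \<open>b'\<close> makes the
  tail geometric, and the finitely many remaining terms are of polynomial size.\<close>

lemma growth_from_coefficients:
  fixes K \<phi> :: "nat \<Rightarrow> real"
  assumes prox: "proximate_order \<rho> \<rho>0" and "0 < \<rho>0"
    and K: "\<And>q. 0 \<le> K q"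
    and \<phi>: "\<forall>\<^sub>F q in sequentially. \<phi> q powr \<rho> (\<phi> q) = q" "filterlim \<phi> at_top sequentially"
    and bd: "\<forall>\<^sub>F q in sequentially. K q \<le> exp (q * (b - ln (\<phi> q)))"
    and "b < b'" and A: "exp b' powr \<rho>0 / (exp 1 * \<rho>0) < A"
  shows "\<forall>\<^sub>F r in at_top. (\<Sum>q. K q * r ^ q) \<le> exp (A * r powr \<rho> r)"
proof -
  obtain d where d: "0 < d" "d < \<rho>0"
    "exp b' powr (\<rho>0 - d) / (exp 1 * (\<rho>0 - d)) < A" "exp b' powr (\<rho>0 + d) / (exp 1 * (\<rho>0 + d)) < A"
    by (rule both_sides_less[where F = "\<lambda>p. exp b' powr p / (exp 1 * p)" and x = \<rho>0 and A = A])
      (use A \<open>0 < \<rho>0\<close> in \<open>auto intro!: continuous_intros\<close>)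
  \<comment> \<open>The room between \<open>A'\<close> and \<open>A\<close> later absorbs the
    constant \<open>2 / (1 - t)\<close>.\<close>
  define A' where "A' = max (exp b' powr (\<rho>0 - d) / (exp 1 * (\<rho>0 - d))) (exp b' powr (\<rho>0 + d) / (exp 1 * (\<rho>0 + d)))"
  have A': "0 < A'" "A' < A" using d \<open>0 < \<rho>0\<close> by (auto simp: A'_def less_max_iff_disj)
  obtain R where R: "1 \<le> R" "\<And>r s. R \<le> r \<Longrightarrow> R \<le> s \<Longrightarrow>
    s powr \<rho> s \<le> r powr \<rho> r * (s / r) powr (\<rho>0 - d) \<or> s powr \<rho> s \<le> r powr \<rho> r * (s / r) powr (\<rho>0 + d)"
    using proximate_order_Potter[OF prox d(1)] by blast
  have "\<forall>\<^sub>F q in sequentially. R \<le> \<phi> q" using \<phi>(2) by (simp add: filterlim_at_top)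
  with \<phi>(1) bd have "\<forall>\<^sub>F q in sequentially. \<phi> q powr \<rho> (\<phi> q) = q \<and> K q \<le> exp (q * (b - ln (\<phi> q))) \<and> R \<le> \<phi> q"
    by eventually_elim auto
  then obtain N where N: "\<And>q. N \<le> q \<Longrightarrow> \<phi> q powr \<rho> (\<phi> q) = q"
    "\<And>q. N \<le> q \<Longrightarrow> K q \<le> exp (q * (b - ln (\<phi> q)))" "\<And>q. N \<le> q \<Longrightarrow> R \<le> \<phi> q"
    by (auto simp: eventually_sequentially)
  \<comment> \<open>Enlarging \<open>b\<close> to \<open>b'\<close> in the exponent leaves the
    factor \<open>t ^ q\<close>, the source of convergence.\<close>
  define t where "t = exp (b - b')"
  have t: "0 < t" "t < 1" using \<open>b < b'\<close> by (auto simp: t_def)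
  have term_le: "K q * r ^ q \<le> t ^ q * exp (A' * r powr \<rho> r)" if "N \<le> q" "R \<le> r" for q r
  proof -
    let ?s = "\<phi> q"
    have pos: "0 < r" "0 < ?s" "R \<le> ?s" using that N(3)[OF that(1)] R(1) by auto
    have u: "0 < ?s / r" using pos by simp
    \<comment> \<open>A nonpositive logarithm is trivial. A positive one may be multiplied by the
      Potter bound for \<open>q = ?s powr \<rho> ?s\<close>, and the product is maximized over
      \<open>?s / r\<close>.\<close>
    have key: "q * ln (exp b' / (?s / r)) \<le> A' * r powr \<rho> r"
    proof (cases "ln (exp b' / (?s / r)) \<le> 0")
      case True
      then have "q * ln (exp b' / (?s / r)) \<le> 0" by (intro mult_nonneg_nonpos) auto
      also have "0 \<le> A' * r powr \<rho> r" using A' by simp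
      finally show ?thesis .
    next
      case False
      have *: ?thesis if p: "real q \<le> r powr \<rho> r * (?s / r) powr p" "0 < p" "exp b' powr p / (exp 1 * p) \<le> A'" for p
      proof -
        have "q * ln (exp b' / (?s / r)) \<le> (r powr \<rho> r * (?s / r) powr p) * ln (exp b' / (?s / r))"
          using p(1) False by (intro mult_right_mono) auto
        also have "\<dots> = r powr \<rho> r * ((?s / r) powr p * ln (exp b' / (?s / r)))" by simp
        also have "\<dots> \<le> r powr \<rho> r * A'"
          using powr_times_ln_le[OF exp_gt_zero u p(2), of b'] p(3) by (intro mult_left_mono) auto
        finally show ?thesis by (simp add: mult.commute)
      qed
      show ?thesis
        using R(2)[OF that(2) pos(3)] *[of "\<rho>0 - d"] *[of "\<rho>0 + d"] d \<open>0 < \<rho>0\<close>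
        unfolding N(1)[OF that(1)] by (auto simp: A'_def)
    qed
    have "K q * r ^ q \<le> exp (q * (b - ln ?s)) * exp (q * ln r)"
      using N(2)[OF that(1)] pos by (simp add: exp_of_nat_mult)
    also have "\<dots> = t ^ q * exp (q * ln (exp b' / (?s / r)))"
      using pos by (simp add: t_def ln_div ln_mult flip: exp_add exp_of_nat_mult) (simp add: algebra_simps ln_mult)
    also have "\<dots> \<le> t ^ q * exp (A' * r powr \<rho> r)"
      using key t by (intro mult_left_mono) auto
    finally show ?thesis .
  qed
  define C where "C = (\<Sum>q<N. K q)"
  have sum_le: "(\<Sum>q. K q * r ^ q) \<le> C * r ^ N + exp (A' * r powr \<rho> r) / (1 - t)" if r: "R \<le> r" for r
  proof -
    have geo: "summable (\<lambda>q. t ^ q * exp (A' * r powr \<rho> r))"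
      using t by (intro summable_mult2 summable_geometric) simp
    have sN: "summable (\<lambda>q. K (q + N) * r ^ (q + N))"
    proof (rule summable_comparison_test[OF exI[of _ 0] summable_ignore_initial_segment[OF geo, of N]])
      show "\<forall>n\<ge>0. norm (K (n + N) * r ^ (n + N)) \<le> t ^ (n + N) * exp (A' * r powr \<rho> r)"
        using term_le[OF _ r] K R(1) r by (simp add: abs_mult)
    qed
    then have s: "summable (\<lambda>q. K q * r ^ q)" by (subst (asm) summable_iff_shift)
    have "(\<Sum>q. K (q + N) * r ^ (q + N)) \<le> (\<Sum>q. t ^ q * exp (A' * r powr \<rho> r))"
    proof (rule suminf_le[OF _ sN geo])
      fix q
      have "K (q + N) * r ^ (q + N) \<le> t ^ (q + N) * exp (A' * r powr \<rho> r)" by (rule term_le[OF _ r]) simp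
      also have "\<dots> \<le> t ^ q * exp (A' * r powr \<rho> r)"
        using t by (intro mult_right_mono power_decreasing) auto
      finally show "K (q + N) * r ^ (q + N) \<le> t ^ q * exp (A' * r powr \<rho> r)" .
    qed
    also have "\<dots> = exp (A' * r powr \<rho> r) / (1 - t)"
      using t by (subst suminf_mult2[symmetric]) (auto simp: summable_geometric suminf_geometric)
    finally have tail: "(\<Sum>q. K (q + N) * r ^ (q + N)) \<le> exp (A' * r powr \<rho> r) / (1 - t)" .
    have "(\<Sum>q<N. K q * r ^ q) \<le> C * r ^ N"
      unfolding C_def sum_distrib_right
      using K R(1) r by (intro sum_mono mult_left_mono power_increasing) auto
    with tail show ?thesis using suminf_split_initial_segment[OF s, of N] by simp
  qed
  have "\<forall>\<^sub>F r in at_top. 2 * C * r ^ N \<le> exp (A * r powr \<rho> r)"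
    by (rule proximate_order_absorb_polynomial[OF prox \<open>0 < \<rho>0\<close>]) (use A' in auto)
  moreover have "\<forall>\<^sub>F r in at_top. 2 / (1 - t) * r ^ 0 \<le> exp ((A - A') * r powr \<rho> r)"
    by (rule proximate_order_absorb_polynomial[OF prox \<open>0 < \<rho>0\<close>]) (use A' in auto)
  \<comment> \<open>Head and tail are each at most half of the target, hence the two factors 2; the
    constant in the tail is absorbed as a polynomial of degree 0.\<close>
  ultimately show ?thesis using eventually_ge_at_top[of R]
  proof eventually_elim
    case (elim r)
    have "exp (A' * r powr \<rho> r) * (2 / (1 - t) * r ^ 0) \<le> exp (A' * r powr \<rho> r) * exp ((A - A') * r powr \<rho> r)"
      using elim by (intro mult_left_mono) auto
    also have "\<dots> = exp (A * r powr \<rho> r)" by (simp add: algebra_simps flip: exp_add)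
    finally have "2 * (exp (A' * r powr \<rho> r) / (1 - t)) \<le> exp (A * r powr \<rho> r)"
      by (simp add: mult.commute)
    with sum_le[of r] elim show ?case by simp
  qed
qed

text \<open>The Cauchy estimate is used at the radius \<open>\<theta> * \<phi> q\<close>. The error
  \<open>\<eta>\<close> is spent in thirds: on the Potter bounds, on the loss
  \<open>1 - 2 * e\<close>, and on the constant. \<open>G r M\<close> stands for a bound
  \<open>M\<close> on the ball of radius \<open>r\<close>.\<close>

lemma coefficients_from_growth:
  fixes K \<phi> :: "nat \<Rightarrow> real"
  assumes prox: "proximate_order \<rho> \<rho>0" and "0 < \<rho>0"
    and \<phi>: "\<forall>\<^sub>F q in sequentially. \<phi> q powr \<rho> (\<phi> q) = q" "filterlim \<phi> at_top sequentially"
    and "0 < A" and growth: "\<forall>\<^sub>F r in at_top. G r (exp (A * r powr \<rho> r))"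
    and Cauchy: "\<And>e. 0 < e \<Longrightarrow> e < 1 / 2 \<Longrightarrow>
      \<exists>C. \<forall>q R M. 0 < R \<longrightarrow> G R M \<longrightarrow> K q * ((1 - 2 * e) * R) ^ q \<le> C * M"
    and "0 < \<eta>"
  shows "\<forall>\<^sub>F q in sequentially. K q \<le> exp (q * ((1 + ln \<rho>0 + ln A) / \<rho>0 + \<eta> - ln (\<phi> q)))"
proof -
  \<comment> \<open>At radius \<open>\<theta> * \<phi> q\<close> the growth exponent is about
    \<open>q * A * \<theta> powr \<rho>0\<close>. This value of \<open>\<theta>\<close> minimizes
    \<open>A * \<theta> powr \<rho>0 - ln \<theta>\<close>, with minimum
    \<open>(1 + ln \<rho>0 + ln A) / \<rho>0\<close>.\<close>
  define \<theta> where "\<theta> = (1 / (A * \<rho>0)) powr (1 / \<rho>0)"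
  have \<theta>: "0 < \<theta>" "\<theta> powr \<rho>0 = 1 / (A * \<rho>0)" "ln \<theta> = - (ln A + ln \<rho>0) / \<rho>0"
    using \<open>0 < A\<close> \<open>0 < \<rho>0\<close> by (auto simp: \<theta>_def powr_powr ln_powr ln_div ln_mult)
  obtain d where d: "0 < d" "A * \<theta> powr (\<rho>0 - d) < 1 / \<rho>0 + \<eta> / 3" "A * \<theta> powr (\<rho>0 + d) < 1 / \<rho>0 + \<eta> / 3"
    by (rule both_sides_less[where F = "\<lambda>p. A * \<theta> powr p" and x = \<rho>0 and A = "1 / \<rho>0 + \<eta> / 3"])
      (use \<theta> \<open>0 < A\<close> \<open>0 < \<rho>0\<close> \<open>0 < \<eta>\<close> in \<open>auto intro!: continuous_intros\<close>)
  obtain R where R: "1 \<le> R" "\<And>r s. R \<le> r \<Longrightarrow> R \<le> s \<Longrightarrow>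
    s powr \<rho> s \<le> r powr \<rho> r * (s / r) powr (\<rho>0 - d) \<or> s powr \<rho> s \<le> r powr \<rho> r * (s / r) powr (\<rho>0 + d)"
    using proximate_order_Potter[OF prox d(1)] by blast
  \<comment> \<open>Solves \<open>- ln (1 - 2 * e) = min 1 (\<eta> / 3)\<close>, so the loss per
    degree stays within a third of \<open>\<eta>\<close>.\<close>
  define e where "e = (1 - exp (- min 1 (\<eta> / 3))) / 2"
  have "exp (- min 1 (\<eta> / 3)) < 1" "0 < exp (- min 1 (\<eta> / 3))" using \<open>0 < \<eta>\<close> by auto
  then have e: "0 < e" "e < 1 / 2" by (auto simp: e_def)
  have "1 - 2 * e = exp (- min 1 (\<eta> / 3))" by (simp add: e_def field_simps)
  then have ln_e: "- ln (1 - 2 * e) \<le> \<eta> / 3" by simp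
  obtain C where C: "\<And>q R M. 0 < R \<Longrightarrow> G R M \<Longrightarrow> K q * ((1 - 2 * e) * R) ^ q \<le> C * M"
    using Cauchy[OF e(1,2)] by blast
  define C' where "C' = max 1 C"
  obtain R' where R': "\<And>r. R' \<le> r \<Longrightarrow> G r (exp (A * r powr \<rho> r))"
    using growth by (auto simp: eventually_at_top_linorder)
  have "\<forall>\<^sub>F q in sequentially. ln C' / (\<eta> / 3) \<le> real q"
    using filterlim_real_sequentially by (simp add: filterlim_at_top)
  moreover have "\<forall>\<^sub>F q in sequentially. max R (max (R / \<theta>) (R' / \<theta>)) \<le> \<phi> q"
    using \<phi>(2) by (simp only: filterlim_at_top)
  \<comment> \<open>The thresholds put \<open>\<phi> q\<close> and
    \<open>\<theta> * \<phi> q\<close> in the range of the Potter bounds, put the radius in the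
    range of the growth bound, and make \<open>C'\<close> at most
    \<open>exp (q * (\<eta> / 3))\<close>.\<close>
  ultimately show ?thesis using \<phi>(1)
  proof eventually_elim
    case (elim q)
    let ?s = "\<phi> q"
    have s: "R \<le> ?s" "R \<le> \<theta> * ?s" "R' \<le> \<theta> * ?s" "0 < ?s"
      using elim(2) \<theta>(1) R(1) by (auto simp: pos_divide_le_eq mult.commute)
    have "(\<theta> * ?s) powr \<rho> (\<theta> * ?s) \<le> q * \<theta> powr (\<rho>0 - d) \<or> (\<theta> * ?s) powr \<rho> (\<theta> * ?s) \<le> q * \<theta> powr (\<rho>0 + d)"
      using R(2)[OF s(1,2)] s(4) by (simp add: elim(3))
    then have AV: "A * (\<theta> * ?s) powr \<rho> (\<theta> * ?s) \<le> q * (1 / \<rho>0 + \<eta> / 3)"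
    proof
      assume *: "(\<theta> * ?s) powr \<rho> (\<theta> * ?s) \<le> q * \<theta> powr (\<rho>0 - d)"
      have "A * (\<theta> * ?s) powr \<rho> (\<theta> * ?s) \<le> A * (q * \<theta> powr (\<rho>0 - d))"
        using * \<open>0 < A\<close> by (intro mult_left_mono) auto
      also have "\<dots> = q * (A * \<theta> powr (\<rho>0 - d))" by simp
      also have "\<dots> \<le> q * (1 / \<rho>0 + \<eta> / 3)" using d by (intro mult_left_mono) auto
      finally show ?thesis .
    next
      assume *: "(\<theta> * ?s) powr \<rho> (\<theta> * ?s) \<le> q * \<theta> powr (\<rho>0 + d)"
      have "A * (\<theta> * ?s) powr \<rho> (\<theta> * ?s) \<le> A * (q * \<theta> powr (\<rho>0 + d))"
        using * \<open>0 < A\<close> by (intro mult_left_mono) auto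
      also have "\<dots> = q * (A * \<theta> powr (\<rho>0 + d))" by simp
      also have "\<dots> \<le> q * (1 / \<rho>0 + \<eta> / 3)" using d by (intro mult_left_mono) auto
      finally show ?thesis .
    qed
    have lnC: "ln C' \<le> q * (\<eta> / 3)"
      using elim(1) \<open>0 < \<eta>\<close> by (simp add: pos_divide_le_eq)
    have pos: "0 < (1 - 2 * e) * (\<theta> * ?s)" using e \<theta>(1) s(4) by simp
    have "K q * ((1 - 2 * e) * (\<theta> * ?s)) ^ q \<le> C * exp (A * (\<theta> * ?s) powr \<rho> (\<theta> * ?s))"
      using C R'[OF s(3)] s(2) R(1) by simp
    also have "\<dots> \<le> C' * exp (A * (\<theta> * ?s) powr \<rho> (\<theta> * ?s))"
      by (intro mult_right_mono) (auto simp: C'_def)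
    also have "\<dots> \<le> exp (q * (\<eta> / 3)) * exp (q * (1 / \<rho>0 + \<eta> / 3))"
    proof (intro mult_mono)
      show "C' \<le> exp (q * (\<eta> / 3))"
        using lnC by (metis C'_def exp_le_cancel_iff exp_ln less_le_trans max.cobounded1 zero_less_one)
    qed (use AV in auto)
    finally have "K q \<le> exp (q * (\<eta> / 3)) * exp (q * (1 / \<rho>0 + \<eta> / 3)) / ((1 - 2 * e) * (\<theta> * ?s)) ^ q"
      using pos by (simp add: pos_le_divide_eq)
    also have "((1 - 2 * e) * (\<theta> * ?s)) ^ q = exp (q * (ln (1 - 2 * e) + ln \<theta> + ln ?s))"
    proof -
      have "(1 - 2 * e) * (\<theta> * ?s) = exp (ln (1 - 2 * e) + ln \<theta> + ln ?s)"
        using e \<theta>(1) s(4) by (simp add: exp_add)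
      then show ?thesis by (simp only: exp_of_nat_mult)
    qed
    also have "exp (q * (\<eta> / 3)) * exp (q * (1 / \<rho>0 + \<eta> / 3)) / \<dots> =
        exp (q * (\<eta> / 3 + (1 / \<rho>0 + \<eta> / 3) - ln (1 - 2 * e) - ln \<theta> - ln ?s))"
      by (simp add: algebra_simps flip: exp_add exp_diff)
    also have "\<dots> \<le> exp (q * ((1 + ln \<rho>0 + ln A) / \<rho>0 + \<eta> - ln ?s))"
      unfolding exp_le_cancel_iff using ln_e \<theta>(3)
      by (intro mult_left_mono) (auto simp: add_divide_distrib diff_divide_distrib)
    finally show ?case .
  qed
qed

section \<open>From extended logarithms to exponential bounds\<close>

text \<open>The right side involves no logarithm, so zeros of \<open>f\<close> and infinite types
  need no separate treatment afterwards.\<close>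

lemma ext_ln_le_iff: "ext_ln t \<le> ereal l \<longleftrightarrow> t \<le> ereal (exp l)"
proof (cases t)
  case (real r)
  have "ln r \<le> l \<longleftrightarrow> r \<le> exp l" if "0 < r"
    using that by (metis exp_le_cancel_iff exp_ln)
  moreover have "r \<le> exp l" if "r \<le> 0" using that exp_gt_zero[of l] by linarith
  ultimately show ?thesis by (auto simp: real ext_ln_def)
qed (auto simp: ext_ln_def)

lemma ext_ln_less_iff: "ext_ln t < ereal l \<longleftrightarrow> t < ereal (exp l)"
proof (cases t)
  case (real r)
  have "ln r < l \<longleftrightarrow> r < exp l" if "0 < r"
    using that by (metis exp_less_cancel_iff exp_ln)
  moreover have "r < exp l" if "r \<le> 0" using that exp_gt_zero[of l] by linarith
  ultimately show ?thesis by (auto simp: real ext_ln_def)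
qed (auto simp: ext_ln_def)

lemma SUP_ext_ln_quotient_le_iff:
  assumes "0 < v"
  shows "(SUP x\<in>S. ext_ln (ereal (g x))) / ereal v \<le> ereal A \<longleftrightarrow> (\<forall>x\<in>S. g x \<le> exp (A * v))"
  using assms by (subst ereal_divide_le_pos) (auto simp: SUP_le_iff ext_ln_le_iff mult.commute)

lemma root_test_term_le_iff:
  assumes "0 < q"
  shows "ereal (1 / real q) * ext_ln (ereal k) + ereal l \<le> ereal c \<longleftrightarrow> k \<le> exp (q * (c - l))"
proof -
  have "ereal (1 / real q) * E + ereal l \<le> ereal c \<longleftrightarrow> E \<le> ereal (q * (c - l))" for E
    using assms by (cases E) (auto simp: field_simps)
  then show ?thesis by (simp add: ext_ln_le_iff)
qed

lemma ereal_le_if_all_real_upper_bounds: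
  assumes "\<And>z. y < ereal z \<Longrightarrow> x \<le> ereal z"
  shows "x \<le> y"
proof (rule ccontr)
  assume "\<not> x \<le> y"
  then obtain z where "y < ereal z" "ereal z < x" using ereal_dense2[of y x] by (auto simp: not_le)
  with assms[of z] show False by simp
qed

section \<open>The inverse of the normalized growth function\<close>

lemma proximate_inverse:
  assumes "normalization_of \<rho>h \<rho> \<rho>0"
  shows "0 < t \<Longrightarrow> 0 < proximate_inverse \<rho>h t"
    and "0 < t \<Longrightarrow> proximate_inverse \<rho>h t powr \<rho>h (proximate_inverse \<rho>h t) = t"
    and "filterlim (\<lambda>q. proximate_inverse \<rho>h (real q)) at_top sequentially"
proof -
  let ?V = "\<lambda>r. r powr \<rho>h r"
  have mono: "strict_mono_on {0<..} ?V" and img: "?V ` {0<..} = {0<..}"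
    using assms by (auto simp: normalization_of_def)
  have inj: "inj_on ?V {0<..}" using mono by (rule strict_mono_on_imp_inj_on)
  show pos: "0 < proximate_inverse \<rho>h t" if "0 < t" for t
    using the_inv_into_into[OF inj, of t "{0<..}"] img that by (simp add: proximate_inverse_def)
  show inv: "?V (proximate_inverse \<rho>h t) = t" if "0 < t" for t
    using f_the_inv_into_f[OF inj, of t] img that by (simp add: proximate_inverse_def)
  show "filterlim (\<lambda>q. proximate_inverse \<rho>h (real q)) at_top sequentially"
    unfolding filterlim_at_top
  proof
    fix Z :: real
    \<comment> \<open>Monotonicity is known on the positive reals only, so the threshold is raised
      to at least 1.\<close>
    define X where "X = max 1 Z"
    have "\<forall>\<^sub>F q in sequentially. max 1 (?V X) \<le> real q"
      using filterlim_real_sequentially unfolding filterlim_at_top by blast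
    then show "\<forall>\<^sub>F q in sequentially. Z \<le> proximate_inverse \<rho>h (real q)"
    proof eventually_elim
      case (elim q)
      let ?s = "proximate_inverse \<rho>h (real q)"
      have q: "0 < real q" using elim by simp
      have "X \<le> ?s"
      proof (rule ccontr)
        assume "\<not> X \<le> ?s"
        then have "?V ?s < ?V X"
          using pos[OF q] by (intro strict_mono_onD[OF mono]) (auto simp: X_def)
        then show False using inv[OF q] elim by simp
      qed
      then show ?case by (simp add: X_def)
    qed
  qed
qed

section \<open>The type formula\<close>

context
  fixes \<rho> \<rho>h :: "real \<Rightarrow> real" and \<rho>0 :: real
    and f :: "'n paravec \<Rightarrow> 'n::{finite,linorder} clifford"
    and a :: "('n \<Rightarrow> nat) \<Rightarrow> 'n clifford"
  assumes \<rho>0: "0 < \<rho>0" and normalization: "normalization_of \<rho>h \<rho> \<rho>0"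
    and has_sum: "\<And>x. ((\<lambda>m. fueter_poly m x \<odot> a m) has_sum f x) UNIV"
begin

abbreviation (input) root_limsup :: ereal where
  "root_limsup \<equiv> limsup (\<lambda>q. ereal (1 / real q) * ext_ln (ereal (homogeneous_sup a q))
                 + ereal (ln (proximate_inverse \<rho>h (real q))))"

lemma proximate_order_h: "proximate_order \<rho>h \<rho>0"
  using normalization by (simp add: normalization_of_def)

lemma eventually_normalization_eq: "\<forall>\<^sub>F r in at_top. \<rho>h r = \<rho> r"
  using normalization by (auto simp: normalization_of_def eventually_at_top_linorder)

lemma eventually_proximate_inverse:
  "\<forall>\<^sub>F q in sequentially. proximate_inverse \<rho>h (real q) powr \<rho>h (proximate_inverse \<rho>h (real q)) = q"
  using eventually_gt_at_top[of 0] by eventually_elim (simp add: proximate_inverse(2)[OF normalization])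

text \<open>The threshold is the solution \<open>b\<close> of
  \<open>exp b powr \<rho>0 / (exp 1 * \<rho>0) = A\<close>, the growth constant of
  \<open>growth_from_coefficients\<close>.\<close>

lemma growth_type_le:
  assumes "0 < A" and "root_limsup < ereal ((1 + ln \<rho>0 + ln A) / \<rho>0)"
  shows "growth_type \<rho> f \<le> ereal A"
proof -
  \<comment> \<open>Two intermediate values are inserted: \<open>b\<close> bounds the coefficients
    eventually, while \<open>b' > b\<close> provides the geometric decay and still lies below the
    threshold.\<close>
  obtain b where b: "root_limsup < ereal b" "b < (1 + ln \<rho>0 + ln A) / \<rho>0"
    using ereal_dense2[OF assms(2)] by auto
  then obtain b' where b': "b < b'" "b' < (1 + ln \<rho>0 + ln A) / \<rho>0"
    using dense by blast
  then have "b' * \<rho>0 < 1 + ln \<rho>0 + ln A" using \<rho>0 by (simp add: pos_less_divide_eq)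
  then have "exp (b' * \<rho>0) < exp (1 + ln \<rho>0 + ln A)" by simp
  then have A: "exp b' powr \<rho>0 / (exp 1 * \<rho>0) < A"
    using \<rho>0 assms(1) by (simp add: exp_add powr_def field_simps)
  have "\<forall>\<^sub>F q in sequentially. homogeneous_sup a q \<le> exp (q * (b - ln (proximate_inverse \<rho>h (real q))))"
    using Limsup_lessD[OF b(1)] eventually_gt_at_top[of 0]
  proof eventually_elim
    case (elim q)
    then show ?case using root_test_term_le_iff[OF elim(2)] less_imp_le by blast
  qed
  then have "\<forall>\<^sub>F r in at_top. (\<Sum>q. homogeneous_sup a q * r ^ q) \<le> exp (A * r powr \<rho>h r)"
    by (intro growth_from_coefficients[OF proximate_order_h \<rho>0 _ eventually_proximate_inverse
          proximate_inverse(3)[OF normalization] _ b'(1) A] homogeneous_sup_nonneg[OF has_sum])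
  then have "\<forall>\<^sub>F r in at_top. (SUP x\<in>cball 0 r. ext_ln (ereal (norm (f x)))) / ereal (r powr \<rho> r) \<le> ereal A"
    using eventually_normalization_eq eventually_gt_at_top[of 0]
  proof eventually_elim
    case (elim r)
    have "norm (f x) \<le> exp (A * r powr \<rho> r)" if "x \<in> cball 0 r" for x
      using norm_le_suminf_homogeneous_sup[OF has_sum, of x r] that elim by simp
    then show ?case using elim by (subst SUP_ext_ln_quotient_le_iff) auto
  qed
  then show ?thesis unfolding growth_type_def by (rule Limsup_bounded)
qed

text \<open>Here \<open>G r M\<close> becomes the bound of \<open>norm (f x)\<close> by
  \<open>M\<close> on \<open>cball 0 r\<close>, so \<open>homogeneous_sup_Cauchy\<close> supplies
  the Cauchy hypothesis of \<open>coefficients_from_growth\<close>; the excess \<open>\<eta>\<close>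
  is arbitrary.\<close>

lemma root_limsup_le:
  assumes "0 < A" and "growth_type \<rho> f < ereal A"
  shows "root_limsup \<le> ereal ((1 + ln \<rho>0 + ln A) / \<rho>0)"
proof (rule ereal_le_epsilon2)
  fix \<eta> :: real assume \<eta>: "0 < \<eta>"
  have "\<forall>\<^sub>F r in at_top. \<forall>x\<in>cball 0 r. norm (f x) \<le> exp (A * r powr \<rho>h r)"
    using Limsup_lessD[OF assms(2)[unfolded growth_type_def]] eventually_normalization_eq eventually_gt_at_top[of 0]
  proof eventually_elim
    case (elim r)
    then show ?case
      using less_imp_le[OF elim(1)]
        SUP_ext_ln_quotient_le_iff[of "r powr \<rho> r" "\<lambda>x. norm (f x)" "cball 0 r" A] by simp
  qed
  then have "\<forall>\<^sub>F q in sequentially. homogeneous_sup a q \<le>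
      exp (q * ((1 + ln \<rho>0 + ln A) / \<rho>0 + \<eta> - ln (proximate_inverse \<rho>h (real q))))"
  proof (rule coefficients_from_growth[OF proximate_order_h \<rho>0 eventually_proximate_inverse
        proximate_inverse(3)[OF normalization] assms(1) _ _ \<eta>])
    fix e :: real assume "0 < e" "e < 1 / 2"
    then show "\<exists>C. \<forall>q R M. 0 < R \<longrightarrow> (\<forall>x\<in>cball 0 R. norm (f x) \<le> M) \<longrightarrow>
        homogeneous_sup a q * ((1 - 2 * e) * R) ^ q \<le> C * M"
      using homogeneous_sup_Cauchy[OF has_sum] by (metis mem_cball_0)
  qed
  then have "\<forall>\<^sub>F q in sequentially. ereal (1 / real q) * ext_ln (ereal (homogeneous_sup a q))
      + ereal (ln (proximate_inverse \<rho>h (real q))) \<le> ereal ((1 + ln \<rho>0 + ln A) / \<rho>0 + \<eta>)"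
    using eventually_gt_at_top[of 0]
    by eventually_elim (simp only: root_test_term_le_iff)
  then show "root_limsup \<le> ereal ((1 + ln \<rho>0 + ln A) / \<rho>0) + ereal \<eta>"
    by (simp add: Limsup_bounded)
qed

text \<open>Both sides are compared through their real strict upper bounds \<open>z\<close>. With
  \<open>A = exp (\<rho>0 * z)\<close> the thresholds of the two sides correspond, and each
  preceding lemma turns a strict bound of one side into a weak bound of the other. This includes
  infinite values.\<close>

lemma growth_type_formula:
  "ereal (1 / \<rho>0) * ext_ln (growth_type \<rho> f) = root_limsup - ereal (1 / \<rho>0) - ereal (ln \<rho>0 / \<rho>0)"
    (is "?l = ?r")
proof -
  have const: "(1 + ln \<rho>0 + ln (exp (\<rho>0 * z))) / \<rho>0 = z + 1 / \<rho>0 + ln \<rho>0 / \<rho>0" for z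
    using \<rho>0 by (simp add: field_simps)
  have l: "?l \<le> ereal z \<longleftrightarrow> growth_type \<rho> f \<le> ereal (exp (\<rho>0 * z))"
    "?l < ereal z \<longleftrightarrow> growth_type \<rho> f < ereal (exp (\<rho>0 * z))" for z
    unfolding ext_ln_le_iff[symmetric] ext_ln_less_iff[symmetric]
    using \<rho>0 by (cases "ext_ln (growth_type \<rho> f)"; simp add: field_simps)+
  have r: "?r \<le> ereal z \<longleftrightarrow> root_limsup \<le> ereal (z + 1 / \<rho>0 + ln \<rho>0 / \<rho>0)"
    "?r < ereal z \<longleftrightarrow> root_limsup < ereal (z + 1 / \<rho>0 + ln \<rho>0 / \<rho>0)" for z
    by (cases root_limsup; auto)+
  show ?thesis
  proof (rule antisym; rule ereal_le_if_all_real_upper_bounds)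
    show "?l \<le> ereal z" if "?r < ereal z" for z
      using growth_type_le[of "exp (\<rho>0 * z)"] that unfolding l r const by simp
    show "?r \<le> ereal z" if "?l < ereal z" for z
      using root_limsup_le[of "exp (\<rho>0 * z)"] that unfolding l r const by simp
  qed
qed

end

theorem theorem3p4:
  fixes \<rho> \<rho>h :: "real \<Rightarrow> real" and \<rho>0 :: real
    and f :: "'n paravec \<Rightarrow> 'n::{finite,linorder} clifford"
    and a :: "('n \<Rightarrow> nat) \<Rightarrow> 'n clifford"
  assumes "0 < \<rho>0" and "proximate_order \<rho> \<rho>0" and "normalization_of \<rho>h \<rho> \<rho>0"
    and "entire_left_monogenic f"
    and "\<And>x. ((\<lambda>m. fueter_poly m x \<odot> a m) has_sum f x) UNIV"
    and "growth_order f = ereal \<rho>0"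
  shows "ereal (1 / \<rho>0) * ext_ln (growth_type \<rho> f) =
    limsup (\<lambda>q. ereal (1 / real q) * ext_ln (ereal (homogeneous_sup a q))
                 + ereal (ln (proximate_inverse \<rho>h (real q))))
      - ereal (1 / \<rho>0) - ereal (ln \<rho>0 / \<rho>0)"
  by (rule growth_type_formula[OF assms(1,3,5)])

end
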